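(* Consider the field–circuit coupled model consisting of the following equations on $[t_0,t_{\mathrm f}]$: (stranded) $M_1\frac{\mathrm d}{\mathrm dt}a_1+K_1a_1-X_{\mathrm{str}}\imath_{\mathrm{str}}=0$, $\;X_{\mathrm{str}}^\top\frac{\mathrm d}{\mathrm dt}a_1+R_{\mathrm{str}}\imath_{\mathrm{str}}-v_{\mathrm{str}}=0$; (solid) $M_2\frac{\mathrm d}{\mathrm dt}a_2+K_2a_2-M_2X_{\mathrm{sol}}v_{\mathrm{sol}}=0$, $\;-X_{\mathrm{sol}}^\top M_2^\top\frac{\mathrm d}{\mathrm dt}a_2+G_{\mathrm{sol}}v_{\mathrm{sol}}-\imath_{\mathrm{sol}}=0$; (foil) $M_3\frac{\mathrm d}{\mathrm dt}a_3+K_3a_3-X_{\mathrm{foil}}\mathbf e=0$, $\;-X_{\mathrm{foil}}^\top\frac{\mathrm d}{\mathrm dt}a_3+G_{\mathrm{foil}}\mathbf e-c\,\imath_{\mathrm{foil}}=0$, $\;-c^\top\mathbf e+v_{\mathrm{foil}}=0$; (circuit) $A_{\mathrm C}CA_{\mathrm C}^\top\frac{\mathrm d}{\mathrm dt}\phi+A_{\mathrm R}GA_{\mathrm R}^\top\phi+A_{\mathrm L}j_{\mathrm L}+A_{\mathrm V}j_{\mathrm V}+A_{\mathrm I}\imath=0$, $\;L\frac{\mathrm d}{\mathrm dt}j_{\mathrm L}-A_{\mathrm L}^\top\phi=0$, $\;A_{\mathrm V}^\top\phi-v=0$; (coupling) $\imath^\top=[\imath_{\mathrm{str}}^\top\;\;\imath_{\mathrm{foil}}\;\;\imath_{\mathrm{src}}^\top]$,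 $\;v^\top=[v_{\mathrm{sol}}^\top\;\;v_{\mathrm{src}}^\top]$, and, with the corresponding splittings $A_{\mathrm I}=[A_{\mathrm{str}}\;\;A_{\mathrm{foil}}\;\;A_{\mathrm{src}}]$ and $j_{\mathrm V}^\top=[j_{\mathrm{sol}}^\top\;\;j_{\mathrm{src}}^\top]$, $\;\imath_{\mathrm{sol}}=j_{\mathrm{sol}}$, $\;v_{\mathrm{str}}=A_{\mathrm{str}}^\top\phi$, $\;v_{\mathrm{foil}}=A_{\mathrm{foil}}^\top\phi$, with external inputs $\imath_{\mathrm{src}}$, $v_{\mathrm{src}}$ (time-dependent current and voltage sources). This coupled model fits into the structure $$\begin{bmatrix}\nabla_{z_1}\mathcal H(z_1,z_2)\\ \mathcal E\frac{\mathrm d}{\mathrm dt}z_2\\ 0\end{bmatrix}=(\mathcal J-\mathcal R)\begin{bmatrix}\frac{\mathrm d}{\mathrm dt}z_1\\ e(z_1,z_2)\\ z_3\end{bmatrix}+\mathcal B u$$ with $\mathcal J=-\mathcal J^\top$, $\mathcal R=\mathcal R^\top$ positive semi-definite, and $\mathcal E^\top e=\nabla_{z_2}\mathcal H$.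
   Context: "Fits into the structure" means: after using the coupling relations to eliminate $\imath,v,\imath_{\mathrm{sol}},v_{\mathrm{str}},v_{\mathrm{foil}}$, the remaining unknowns $a_1,\imath_{\mathrm{str}},a_2,v_{\mathrm{sol}},a_3,\mathbf e,\imath_{\mathrm{foil}},\phi,j_{\mathrm L},j_{\mathrm V}$ can be grouped into components $z_1,z_2,z_3$ and, with $u$ formed by the external inputs $\imath_{\mathrm{src}},v_{\mathrm{src}}$, there exist a function $\mathcal H\in C^1$ of $(z_1,z_2)$, a continuous function $e$ of $(z_1,z_2)$ with values in the space of $z_2$, and real constant matrices $\mathcal E$ (square, possibly singular), $\mathcal J=-\mathcal J^\top$, $\mathcal R=\mathcal R^\top\ge0$, $\mathcal B$ of appropriate sizes, with $\mathcal E^\top e(z_1,z_2)=\nabla_{z_2}\mathcal H(z_1,z_2)$ for all $(z_1,z_2)$, such that the model equations are equivalent to the displayed structured system. Field matrices. Each of the three field models ($q=1,2,3$) is posed on a simply connected Lipschitz domain $\Omega\subset\mathbb R^3$ (possibly different for each $q$), with edge-element finite element basis functions $w_1,\dots,w_{n_w}\in H(\mathrm{curl};\Omega)$ of vanishing tangential trace, constant reluctivity $\nu>0$, and conductivity $\sigma$ equal to a constant $\sigma_{\mathrm c}>0$ on a subdomain $\Omega_{\mathrm c}$ and $0$ elsewhere, and $$[M_q]_{ij}=\int_\Omega\sigma\,w_j\cdot w_i\,\mathrm dV,\qquad[K_q]_{ij}=\int_\Omega\nu\,(\nabla\times w_j)\cdot(\nabla\times w_i)\,\mathrm dV;$$ it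 is assumed that (after gauging) the pencil $\lambda M_q+K_q$ is regular. The unknowns $a_q$ are the coefficient vectors of the magnetic vector potential. Stranded ($\imath_{\mathrm{str}},v_{\mathrm{str}}$ are $\mathbb R^{n_{\mathrm{str}}}$-valued): $[X_{\mathrm{str}}]_{ik}=\int_\Omega\chi_{\mathrm{str},k}\cdot w_i\,\mathrm dV$ with winding functions $\chi_{\mathrm{str},k}$ supported on disjoint stranded conductor domains with union $\Omega_{\mathrm{str}}$, contained in the region where $\sigma=0$; $R_{\mathrm{str}}=X_{\mathrm{str}}^\top M_{\mathrm{str}}^{+}X_{\mathrm{str}}$, where $M_{\mathrm{str}}$ is defined like $M_1$ but with the conductivity set to a constant $\sigma_{\mathrm{str}}>0$ on $\Omega_{\mathrm{str}}$, and $(\cdot)^{+}$ is the Moore–Penrose pseudo-inverse. Solid ($\imath_{\mathrm{sol}},v_{\mathrm{sol}}$ are $\mathbb R^{n_{\mathrm{sol}}}$-valued): the columns of $X_{\mathrm{sol}}$ are coefficient vectors with respect to $(w_i)$ of voltage distribution functions supported on disjoint subdomains of $\Omega_{\mathrm c}$; $G_{\mathrm{sol}}=X_{\mathrm{sol}}^\top M_2X_{\mathrm{sol}}$. Foil ($\imath_{\mathrm{foil}},v_{\mathrm{foil}}$ scalar, $\mathbf e$ is $\mathbb R^{n_p}$-valued): $[X_{\mathrm{foil}}]_{i\ell}=\sum_jx_j\int_\Omega\sigma\,p_\ell\,w_j\cdot w_i\,\mathrm dV$ and $[c]_k=\frac1b\int_\Lambda p_k\,\mathrm ds$, where $p_1,\dots,p_{n_p}$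 are scalar finite element basis functions, $x$ is the coordinate vector of a given distribution function with respect to $(w_i)$, $b>0$ is the foil thickness, and $\Lambda$ is a fixed one-dimensional curve crossing the foils in thickness direction (all integrals assumed well defined); $G_{\mathrm{foil}}=X_{\mathrm{foil}}^\top M_3^{+}X_{\mathrm{foil}}$. Circuit: $A_\star\in\mathbb R^{(n_\phi-1)\times b_\star}$, $\star\in\{\mathrm C,\mathrm R,\mathrm L,\mathrm V,\mathrm I\}$, are incidence matrices ($A_{\mathrm C}$ need not have full row rank); $C,G,L$ (capacitances, conductances, inductances) are symmetric positive definite; $\phi$ are node potentials, $j_{\mathrm L},j_{\mathrm V}$ currents through inductances and voltage sources, $\imath,v$ source currents and voltages. *)

theory Defs
  imports
    "HOL-Analysis.Analysis"
    "Jordan_Normal_Form.Matrix"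
    "Jordan_Normal_Form.Determinant"
begin

text \<open>Matrices and vectors of variable (possibly zero) size are those of
  \<^theory>\<open>Jordan_Normal_Form.Matrix\<close>; the type \<^typ>\<open>real ^ 3\<close> is only used for points and
  vectors of physical space.\<close>

unbundle no vec_syntax
hide_const (open) Finite_Cartesian_Product.vec Finite_Cartesian_Product.mat Determinants.det

section \<open>Matrices\<close>

definition symmetric_mat :: "nat \<Rightarrow> real mat \<Rightarrow> bool" where
  "symmetric_mat n A \<longleftrightarrow> A \<in> carrier_mat n n \<and> transpose_mat A = A"

definition skew_symmetric_mat :: "nat \<Rightarrow> real mat \<Rightarrow> bool" where
  "skew_symmetric_mat n A \<longleftrightarrow> A \<in> carrier_mat n n \<and> A = - transpose_mat A"

definition sym_pos_semidef :: "nat \<Rightarrow> real mat \<Rightarrow> bool" where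
  "sym_pos_semidef n A \<longleftrightarrow>
     symmetric_mat n A \<and> (\<forall>x \<in> carrier_vec n. 0 \<le> x \<bullet> (A *\<^sub>v x))"

definition sym_pos_def :: "nat \<Rightarrow> real mat \<Rightarrow> bool" where
  "sym_pos_def n A \<longleftrightarrow>
     symmetric_mat n A \<and> (\<forall>x \<in> carrier_vec n. x \<noteq> 0\<^sub>v n \<longrightarrow> 0 < x \<bullet> (A *\<^sub>v x))"

definition is_moore_penrose :: "real mat \<Rightarrow> real mat \<Rightarrow> bool" where
  "is_moore_penrose A P \<longleftrightarrow>
     P \<in> carrier_mat (dim_col A) (dim_row A) \<and>
     A * P * A = A \<and> P * A * P = P \<and>
     transpose_mat (A * P) = A * P \<and> transpose_mat (P * A) = P * A"

definition pinv :: "real mat \<Rightarrow> real mat" where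
  "pinv A = (THE P. is_moore_penrose A P)"

text \<open>Regularity of \<open>\<lambda>M + K\<close>: its determinant does not vanish for every complex \<open>\<lambda>\<close>.\<close>

definition regular_pencil :: "real mat \<Rightarrow> real mat \<Rightarrow> bool" where
  "regular_pencil M K \<longleftrightarrow>
     (\<exists>l :: complex. Determinant.det
        (l \<cdot>\<^sub>m map_mat complex_of_real M + map_mat complex_of_real K) \<noteq> 0)"

definition col_block :: "real mat \<Rightarrow> nat \<Rightarrow> nat \<Rightarrow> real mat" where
  "col_block A k n = mat (dim_row A) n (\<lambda>(i, j). A $$ (i, k + j))"

section \<open>Function spaces\<close>

text \<open>Near each boundary point the domain is, in suitable Cartesian coordinates, the set of
  points strictly above the graph of a Lipschitz function.\<close>

definition lipschitz_domain :: "(real ^ 3) set \<Rightarrow> bool" where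
  "lipschitz_domain S \<longleftrightarrow> open S \<and> connected S \<and> S \<noteq> {} \<and> bounded S \<and>
     (\<forall>p \<in> frontier S. \<exists>r > 0. \<exists>T :: real ^ 3 \<Rightarrow> real ^ 3. \<exists>g :: real ^ 2 \<Rightarrow> real. \<exists>C.
        orthogonal_transformation T \<and> lipschitz_on C UNIV g \<and>
        S \<inter> ball p r =
          {x \<in> ball p r. g (vector [vec_nth (T x) 1, vec_nth (T x) 2]) < vec_nth (T x) 3})"

primrec Ck :: "nat \<Rightarrow> (real ^ 3 \<Rightarrow> real ^ 3) \<Rightarrow> bool" where
  "Ck 0 f \<longleftrightarrow> continuous_on UNIV f"
| "Ck (Suc k) f \<longleftrightarrow> (\<forall>x. f differentiable (at x)) \<and>
     (\<forall>v. Ck k (\<lambda>x. frechet_derivative f (at x) v))"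

definition smooth_field :: "(real ^ 3 \<Rightarrow> real ^ 3) \<Rightarrow> bool" where
  "smooth_field f \<longleftrightarrow> (\<forall>k. Ck k f)"

definition pderiv3 :: "(real ^ 3 \<Rightarrow> real ^ 3) \<Rightarrow> 3 \<Rightarrow> 3 \<Rightarrow> real ^ 3 \<Rightarrow> real" where
  "pderiv3 f i j x = vec_nth (frechet_derivative f (at x) (axis i 1)) j"

definition curl :: "(real ^ 3 \<Rightarrow> real ^ 3) \<Rightarrow> real ^ 3 \<Rightarrow> real ^ 3" where
  "curl f x = vector [pderiv3 f 2 3 x - pderiv3 f 3 2 x,
                      pderiv3 f 3 1 x - pderiv3 f 1 3 x,
                      pderiv3 f 1 2 x - pderiv3 f 2 1 x]"

definition L2_field :: "(real ^ 3) set \<Rightarrow> (real ^ 3 \<Rightarrow> real ^ 3) \<Rightarrow> bool" where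
  "L2_field S f \<longleftrightarrow> f \<in> borel_measurable (lebesgue_on S) \<and>
     integrable (lebesgue_on S) (\<lambda>x. (norm (f x))\<^sup>2)"

definition has_weak_curl ::
  "(real ^ 3) set \<Rightarrow> (real ^ 3 \<Rightarrow> real ^ 3) \<Rightarrow> (real ^ 3 \<Rightarrow> real ^ 3) \<Rightarrow> bool" where
  "has_weak_curl S f c \<longleftrightarrow> L2_field S c \<and>
     (\<forall>\<phi>. smooth_field \<phi> \<and> compact (closure {x. \<phi> x \<noteq> 0}) \<and> closure {x. \<phi> x \<noteq> 0} \<subseteq> S \<longrightarrow>
        (LINT x|lebesgue_on S. inner (c x) (\<phi> x)) = (LINT x|lebesgue_on S. inner (f x) (curl \<phi> x)))"

definition Hcurl :: "(real ^ 3) set \<Rightarrow> (real ^ 3 \<Rightarrow> real ^ 3) set" where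
  "Hcurl S = {f. L2_field S f \<and> (\<exists>c. has_weak_curl S f c)}"

text \<open>The weak curl is unique up to a null set; it only occurs under integrals.\<close>

definition weak_curl :: "(real ^ 3) set \<Rightarrow> (real ^ 3 \<Rightarrow> real ^ 3) \<Rightarrow> real ^ 3 \<Rightarrow> real ^ 3" where
  "weak_curl S f = (SOME c. has_weak_curl S f c)"

text \<open>The tangential trace of a field in \<open>H(curl)\<close> is defined through Green's formula
  \<open>\<integral>\<^sub>S (curl f \<bullet> \<phi> - f \<bullet> curl \<phi>) = \<langle>n \<times> f, \<phi>\<rangle>\<close>, the right-hand side being
  the boundary pairing, with \<open>\<phi>\<close> smooth up to the boundary.\<close>

definition zero_tangential_trace :: "(real ^ 3) set \<Rightarrow> (real ^ 3 \<Rightarrow> real ^ 3) \<Rightarrow> bool" where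
  "zero_tangential_trace S f \<longleftrightarrow>
     (\<forall>\<phi>. smooth_field \<phi> \<longrightarrow>
        (LINT x|lebesgue_on S. inner (weak_curl S f x) (\<phi> x)) =
        (LINT x|lebesgue_on S. inner (f x) (curl \<phi> x)))"

section \<open>Field models\<close>

record field_model =
  dom :: "(real ^ 3) set"
  dom_c :: "(real ^ 3) set"
  reluct :: real
  conduct :: real
  n_w :: nat
  edge_fun :: "nat \<Rightarrow> real ^ 3 \<Rightarrow> real ^ 3"

definition sigma :: "field_model \<Rightarrow> real ^ 3 \<Rightarrow> real" where
  "sigma F x = (if x \<in> dom_c F then conduct F else 0)"

definition mass_mat :: "field_model \<Rightarrow> (real ^ 3 \<Rightarrow> real) \<Rightarrow> real mat" where
  "mass_mat F s = mat (n_w F) (n_w F) (\<lambda>(i, j).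
     LINT x|lebesgue_on (dom F). s x * inner (edge_fun F j x) (edge_fun F i x))"

definition M_mat :: "field_model \<Rightarrow> real mat" where
  "M_mat F = mass_mat F (sigma F)"

definition K_mat :: "field_model \<Rightarrow> real mat" where
  "K_mat F = mat (n_w F) (n_w F) (\<lambda>(i, j).
     LINT x|lebesgue_on (dom F). reluct F *
       inner (weak_curl (dom F) (edge_fun F j) x) (weak_curl (dom F) (edge_fun F i) x))"

text \<open>A gauge by elimination of basis functions is already contained in the family
  \<^const>\<open>edge_fun\<close>. Regularity of the pencil entails linear independence of this family.\<close>

definition valid_field_model :: "field_model \<Rightarrow> bool" where
  "valid_field_model F \<longleftrightarrow>
     lipschitz_domain (dom F) \<and> simply_connected (dom F) \<and>
     open (dom_c F) \<and> dom_c F \<subseteq> dom F \<and> 0 < reluct F \<and> 0 < conduct F \<and>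
     (\<forall>i < n_w F. edge_fun F i \<in> Hcurl (dom F) \<and> zero_tangential_trace (dom F) (edge_fun F i)) \<and>
     regular_pencil (M_mat F) (K_mat F)"

definition supported_on ::
  "field_model \<Rightarrow> (real ^ 3 \<Rightarrow> real ^ 3) \<Rightarrow> (real ^ 3) set \<Rightarrow> bool" where
  "supported_on F f S \<longleftrightarrow> (AE x in lebesgue_on (dom F). x \<notin> S \<longrightarrow> f x = 0)"

definition lin_comb :: "field_model \<Rightarrow> real vec \<Rightarrow> real ^ 3 \<Rightarrow> real ^ 3" where
  "lin_comb F y x = (\<Sum>i < n_w F. (y $ i) *\<^sub>R edge_fun F i x)"

section \<open>Conductor models\<close>

record stranded =
  n_str :: nat
  str_dom :: "nat \<Rightarrow> (real ^ 3) set"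
  chi_str :: "nat \<Rightarrow> real ^ 3 \<Rightarrow> real ^ 3"
  sigma_str :: real

definition valid_stranded :: "field_model \<Rightarrow> stranded \<Rightarrow> bool" where
  "valid_stranded F S \<longleftrightarrow> 0 < sigma_str S \<and>
     (\<forall>k < n_str S. open (str_dom S k) \<and> str_dom S k \<subseteq> dom F - dom_c F \<and>
        supported_on F (chi_str S k) (str_dom S k) \<and>
        (\<forall>i < n_w F. integrable (lebesgue_on (dom F))
           (\<lambda>x. inner (chi_str S k x) (edge_fun F i x)))) \<and>
     disjoint_family_on (str_dom S) {..<n_str S}"

definition X_str :: "field_model \<Rightarrow> stranded \<Rightarrow> real mat" where
  "X_str F S = mat (n_w F) (n_str S) (\<lambda>(i, k).
     LINT x|lebesgue_on (dom F). inner (chi_str S k x) (edge_fun F i x))"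

definition M_str :: "field_model \<Rightarrow> stranded \<Rightarrow> real mat" where
  "M_str F S = mass_mat F
     (\<lambda>x. if x \<in> (\<Union>k < n_str S. str_dom S k) then sigma_str S else 0)"

definition R_str :: "field_model \<Rightarrow> stranded \<Rightarrow> real mat" where
  "R_str F S = transpose_mat (X_str F S) * pinv (M_str F S) * X_str F S"

record solid =
  n_sol :: nat
  sol_dom :: "nat \<Rightarrow> (real ^ 3) set"
  X_sol :: "real mat"

definition valid_solid :: "field_model \<Rightarrow> solid \<Rightarrow> bool" where
  "valid_solid F S \<longleftrightarrow> X_sol S \<in> carrier_mat (n_w F) (n_sol S) \<and>
     (\<forall>k < n_sol S. open (sol_dom S k) \<and> sol_dom S k \<subseteq> dom_c F \<and>
        supported_on F (lin_comb F (col (X_sol S) k)) (sol_dom S k)) \<and>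
     disjoint_family_on (sol_dom S) {..<n_sol S}"

definition G_sol :: "field_model \<Rightarrow> solid \<Rightarrow> real mat" where
  "G_sol F S = transpose_mat (X_sol S) * M_mat F * X_sol S"

text \<open>The curve \<open>\<Lambda>\<close> is given by a piecewise continuously differentiable parametrisation
  \<open>Lam\<close> on \<open>[0, 1]\<close>; \<open>x_foil\<close> holds the coordinates of the distribution function.\<close>

record foil =
  n_p :: nat
  p_fun :: "nat \<Rightarrow> real ^ 3 \<Rightarrow> real"
  x_foil :: "real vec"
  thick :: real
  Lam :: "real \<Rightarrow> real ^ 3"

definition valid_foil :: "field_model \<Rightarrow> foil \<Rightarrow> bool" where
  "valid_foil F S \<longleftrightarrow> x_foil S \<in> carrier_vec (n_w F) \<and> 0 < thick S \<and>
     arc (Lam S) \<and> valid_path (Lam S) \<and> path_image (Lam S) \<subseteq> closure (dom F) \<and>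
     (\<forall>l < n_p S.
        (\<forall>i < n_w F. \<forall>j < n_w F. integrable (lebesgue_on (dom F))
           (\<lambda>x. sigma F x * p_fun S l x * inner (edge_fun F j x) (edge_fun F i x))) \<and>
        integrable (lebesgue_on {0..1})
           (\<lambda>s. p_fun S l (Lam S s) * norm (vector_derivative (Lam S) (at s))))"

definition X_foil :: "field_model \<Rightarrow> foil \<Rightarrow> real mat" where
  "X_foil F S = mat (n_w F) (n_p S) (\<lambda>(i, l).
     \<Sum>j < n_w F. (x_foil S $ j) * (LINT x|lebesgue_on (dom F).
        sigma F x * p_fun S l x * inner (edge_fun F j x) (edge_fun F i x)))"

definition c_foil :: "foil \<Rightarrow> real vec" where
  "c_foil S = vec (n_p S) (\<lambda>k. 1 / thick S * (LINT s|lebesgue_on {0..1}.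
     p_fun S k (Lam S s) * norm (vector_derivative (Lam S) (at s))))"

definition G_foil :: "field_model \<Rightarrow> foil \<Rightarrow> real mat" where
  "G_foil F S = transpose_mat (X_foil F S) * pinv (M_mat F) * X_foil F S"

section \<open>Circuit\<close>

record circuit =
  n_phi :: nat
  n_C :: nat
  n_R :: nat
  n_L :: nat
  n_isrc :: nat
  n_vsrc :: nat
  A_C :: "real mat"
  A_R :: "real mat"
  A_L :: "real mat"
  A_V :: "real mat"
  A_I :: "real mat"
  cap :: "real mat"
  cond :: "real mat"
  indu :: "real mat"

text \<open>Incidence matrix of a directed graph on the nodes \<open>0, \<dots>, n - 1\<close> with \<open>b\<close> branches, the
  row of the reference node \<open>n - 1\<close> being removed.\<close>

definition incidence_mat :: "nat \<Rightarrow> nat \<Rightarrow> real mat \<Rightarrow> bool" where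
  "incidence_mat n b A \<longleftrightarrow> A \<in> carrier_mat (n - 1) b \<and>
     (\<exists>tail head. \<forall>k < b. tail k < n \<and> head k < n \<and> tail k \<noteq> head k \<and>
        (\<forall>i < n - 1. A $$ (i, k) = (if i = tail k then 1 else if i = head k then - 1 else 0)))"

definition valid_circuit :: "stranded \<Rightarrow> solid \<Rightarrow> circuit \<Rightarrow> bool" where
  "valid_circuit St So N \<longleftrightarrow>
     incidence_mat (n_phi N) (n_C N) (A_C N) \<and>
     incidence_mat (n_phi N) (n_R N) (A_R N) \<and>
     incidence_mat (n_phi N) (n_L N) (A_L N) \<and>
     incidence_mat (n_phi N) (n_sol So + n_vsrc N) (A_V N) \<and>
     incidence_mat (n_phi N) (n_str St + 1 + n_isrc N) (A_I N) \<and>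
     sym_pos_def (n_C N) (cap N) \<and> sym_pos_def (n_R N) (cond N) \<and> sym_pos_def (n_L N) (indu N)"

text \<open>\<open>A\<^sub>I = [A\<^sub>s\<^sub>t\<^sub>r A\<^sub>f\<^sub>o\<^sub>i\<^sub>l A\<^sub>s\<^sub>r\<^sub>c]\<close>\<close>

definition A_str :: "stranded \<Rightarrow> circuit \<Rightarrow> real mat" where
  "A_str St N = col_block (A_I N) 0 (n_str St)"

definition A_foil :: "stranded \<Rightarrow> circuit \<Rightarrow> real vec" where
  "A_foil St N = col (A_I N) (n_str St)"

section \<open>Time-dependent quantities\<close>

definition vec_differentiable_on :: "(real \<Rightarrow> real vec) \<Rightarrow> real set \<Rightarrow> bool" where
  "vec_differentiable_on x T \<longleftrightarrow>
     (\<forall>t \<in> T. \<forall>i < dim_vec (x t). (\<lambda>s. x s $ i) differentiable (at t within T))"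

definition ddt :: "real set \<Rightarrow> (real \<Rightarrow> real vec) \<Rightarrow> real \<Rightarrow> real vec" where
  "ddt T x t = vec (dim_vec (x t)) (\<lambda>i. vector_derivative (\<lambda>s. x s $ i) (at t within T))"

record signals =
  a1 :: "real \<Rightarrow> real vec"
  i_str :: "real \<Rightarrow> real vec"
  v_str :: "real \<Rightarrow> real vec"
  a2 :: "real \<Rightarrow> real vec"
  v_sol :: "real \<Rightarrow> real vec"
  i_sol :: "real \<Rightarrow> real vec"
  a3 :: "real \<Rightarrow> real vec"
  e_foil :: "real \<Rightarrow> real vec"
  i_foil :: "real \<Rightarrow> real"
  v_foil :: "real \<Rightarrow> real"
  phi :: "real \<Rightarrow> real vec"
  j_L :: "real \<Rightarrow> real vec"
  j_V :: "real \<Rightarrow> real vec"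
  i_all :: "real \<Rightarrow> real vec"
  v_all :: "real \<Rightarrow> real vec"
  i_src :: "real \<Rightarrow> real vec"
  v_src :: "real \<Rightarrow> real vec"

record model =
  field1 :: field_model
  field2 :: field_model
  field3 :: field_model
  strand :: stranded
  sol :: solid
  foi :: foil
  circ :: circuit

definition valid_model :: "model \<Rightarrow> bool" where
  "valid_model D \<longleftrightarrow>
     valid_field_model (field1 D) \<and> valid_field_model (field2 D) \<and> valid_field_model (field3 D) \<and>
     valid_stranded (field1 D) (strand D) \<and> valid_solid (field2 D) (sol D) \<and>
     valid_foil (field3 D) (foi D) \<and> valid_circuit (strand D) (sol D) (circ D)"

definition signal_dims :: "model \<Rightarrow> real set \<Rightarrow> signals \<Rightarrow> bool" where
  "signal_dims D T s \<longleftrightarrow> (\<forall>t \<in> T.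
     a1 s t \<in> carrier_vec (n_w (field1 D)) \<and>
     i_str s t \<in> carrier_vec (n_str (strand D)) \<and>
     v_str s t \<in> carrier_vec (n_str (strand D)) \<and>
     a2 s t \<in> carrier_vec (n_w (field2 D)) \<and>
     v_sol s t \<in> carrier_vec (n_sol (sol D)) \<and>
     i_sol s t \<in> carrier_vec (n_sol (sol D)) \<and>
     a3 s t \<in> carrier_vec (n_w (field3 D)) \<and>
     e_foil s t \<in> carrier_vec (n_p (foi D)) \<and>
     phi s t \<in> carrier_vec (n_phi (circ D) - 1) \<and>
     j_L s t \<in> carrier_vec (n_L (circ D)) \<and>
     j_V s t \<in> carrier_vec (n_sol (sol D) + n_vsrc (circ D)) \<and>
     i_all s t \<in> carrier_vec (n_str (strand D) + 1 + n_isrc (circ D)) \<and>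
     v_all s t \<in> carrier_vec (n_sol (sol D) + n_vsrc (circ D)) \<and>
     i_src s t \<in> carrier_vec (n_isrc (circ D)) \<and>
     v_src s t \<in> carrier_vec (n_vsrc (circ D)))"

section \<open>The coupled model\<close>

definition stranded_eqs :: "model \<Rightarrow> real set \<Rightarrow> signals \<Rightarrow> bool" where
  "stranded_eqs D T s \<longleftrightarrow> vec_differentiable_on (a1 s) T \<and>
     (let F = field1 D; S = strand D; X = X_str F S in \<forall>t \<in> T.
        M_mat F *\<^sub>v ddt T (a1 s) t + K_mat F *\<^sub>v a1 s t - X *\<^sub>v i_str s t = 0\<^sub>v (n_w F) \<and>
        transpose_mat X *\<^sub>v ddt T (a1 s) t + R_str F S *\<^sub>v i_str s t - v_str s t = 0\<^sub>v (n_str S))"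

definition solid_eqs :: "model \<Rightarrow> real set \<Rightarrow> signals \<Rightarrow> bool" where
  "solid_eqs D T s \<longleftrightarrow> vec_differentiable_on (a2 s) T \<and>
     (let F = field2 D; S = sol D; M = M_mat F; X = X_sol S in \<forall>t \<in> T.
        M *\<^sub>v ddt T (a2 s) t + K_mat F *\<^sub>v a2 s t - (M * X) *\<^sub>v v_sol s t = 0\<^sub>v (n_w F) \<and>
        - ((transpose_mat X * transpose_mat M) *\<^sub>v ddt T (a2 s) t)
          + G_sol F S *\<^sub>v v_sol s t - i_sol s t = 0\<^sub>v (n_sol S))"

definition foil_eqs :: "model \<Rightarrow> real set \<Rightarrow> signals \<Rightarrow> bool" where
  "foil_eqs D T s \<longleftrightarrow> vec_differentiable_on (a3 s) T \<and>
     (let F = field3 D; S = foi D; X = X_foil F S in \<forall>t \<in> T.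
        M_mat F *\<^sub>v ddt T (a3 s) t + K_mat F *\<^sub>v a3 s t - X *\<^sub>v e_foil s t = 0\<^sub>v (n_w F) \<and>
        - (transpose_mat X *\<^sub>v ddt T (a3 s) t)
          + G_foil F S *\<^sub>v e_foil s t - i_foil s t \<cdot>\<^sub>v c_foil S = 0\<^sub>v (n_p S) \<and>
        - (c_foil S \<bullet> e_foil s t) + v_foil s t = 0)"

definition circuit_eqs :: "model \<Rightarrow> real set \<Rightarrow> signals \<Rightarrow> bool" where
  "circuit_eqs D T s \<longleftrightarrow> vec_differentiable_on (phi s) T \<and> vec_differentiable_on (j_L s) T \<and>
     (let N = circ D in \<forall>t \<in> T.
        (A_C N * cap N * transpose_mat (A_C N)) *\<^sub>v ddt T (phi s) t
          + (A_R N * cond N * transpose_mat (A_R N)) *\<^sub>v phi s t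
          + A_L N *\<^sub>v j_L s t + A_V N *\<^sub>v j_V s t + A_I N *\<^sub>v i_all s t = 0\<^sub>v (n_phi N - 1) \<and>
        indu N *\<^sub>v ddt T (j_L s) t - transpose_mat (A_L N) *\<^sub>v phi s t = 0\<^sub>v (n_L N) \<and>
        transpose_mat (A_V N) *\<^sub>v phi s t - v_all s t = 0\<^sub>v (n_sol (sol D) + n_vsrc N))"

definition coupling_eqs :: "model \<Rightarrow> real set \<Rightarrow> signals \<Rightarrow> bool" where
  "coupling_eqs D T s \<longleftrightarrow> (let N = circ D; S = strand D in \<forall>t \<in> T.
     i_all s t = i_str s t @\<^sub>v vec 1 (\<lambda>_. i_foil s t) @\<^sub>v i_src s t \<and>
     v_all s t = v_sol s t @\<^sub>v v_src s t \<and>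
     i_sol s t = vec_first (j_V s t) (n_sol (sol D)) \<and>
     v_str s t = transpose_mat (A_str S N) *\<^sub>v phi s t \<and>
     v_foil s t = A_foil S N \<bullet> phi s t)"

definition coupled_model :: "model \<Rightarrow> real set \<Rightarrow> signals \<Rightarrow> bool" where
  "coupled_model D T s \<longleftrightarrow>
     stranded_eqs D T s \<and> solid_eqs D T s \<and> foil_eqs D T s \<and> circuit_eqs D T s \<and>
     coupling_eqs D T s"

section \<open>The target structure\<close>

definition grad1 :: "nat \<Rightarrow> (real vec \<Rightarrow> real vec \<Rightarrow> real) \<Rightarrow> real vec \<Rightarrow> real vec \<Rightarrow> real vec" where
  "grad1 n1 H z1 z2 = vec n1 (\<lambda>i. deriv (\<lambda>h. H (z1 + h \<cdot>\<^sub>v unit_vec n1 i) z2) 0)"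

definition grad2 :: "nat \<Rightarrow> (real vec \<Rightarrow> real vec \<Rightarrow> real) \<Rightarrow> real vec \<Rightarrow> real vec \<Rightarrow> real vec" where
  "grad2 n2 H z1 z2 = vec n2 (\<lambda>i. deriv (\<lambda>h. H z1 (z2 + h \<cdot>\<^sub>v unit_vec n2 i)) 0)"

text \<open>\<open>vec n\<close> maps a sequence in \<open>nat \<Rightarrow> real\<close> (with the product topology) to its first \<open>n\<close>
  entries, which is an open surjection onto \<open>\<real>\<^sup>n\<close>; so this is Euclidean continuity.\<close>

definition continuous_vec2 :: "nat \<Rightarrow> nat \<Rightarrow> (real vec \<Rightarrow> real vec \<Rightarrow> real) \<Rightarrow> bool" where
  "continuous_vec2 n1 n2 f \<longleftrightarrow>
     continuous_on UNIV (\<lambda>(x :: nat \<Rightarrow> real, y :: nat \<Rightarrow> real). f (vec n1 x) (vec n2 y))"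

definition C1_vec2 :: "nat \<Rightarrow> nat \<Rightarrow> (real vec \<Rightarrow> real vec \<Rightarrow> real) \<Rightarrow> bool" where
  "C1_vec2 n1 n2 H \<longleftrightarrow>
     (\<forall>z1 \<in> carrier_vec n1. \<forall>z2 \<in> carrier_vec n2.
        (\<forall>i < n1. (\<lambda>h. H (z1 + h \<cdot>\<^sub>v unit_vec n1 i) z2) field_differentiable (at 0)) \<and>
        (\<forall>i < n2. (\<lambda>h. H z1 (z2 + h \<cdot>\<^sub>v unit_vec n2 i)) field_differentiable (at 0))) \<and>
     (\<forall>i < n1. continuous_vec2 n1 n2 (\<lambda>z1 z2. grad1 n1 H z1 z2 $ i)) \<and>
     (\<forall>i < n2. continuous_vec2 n1 n2 (\<lambda>z1 z2. grad2 n2 H z1 z2 $ i))"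

definition admissible_structure ::
  "nat \<Rightarrow> nat \<Rightarrow> nat \<Rightarrow> nat \<Rightarrow> (real vec \<Rightarrow> real vec \<Rightarrow> real) \<Rightarrow> (real vec \<Rightarrow> real vec \<Rightarrow> real vec) \<Rightarrow>
   real mat \<Rightarrow> real mat \<Rightarrow> real mat \<Rightarrow> real mat \<Rightarrow> bool" where
  "admissible_structure n1 n2 n3 m H e E J R B \<longleftrightarrow>
     C1_vec2 n1 n2 H \<and>
     (\<forall>z1 \<in> carrier_vec n1. \<forall>z2 \<in> carrier_vec n2. e z1 z2 \<in> carrier_vec n2) \<and>
     (\<forall>i < n2. continuous_vec2 n1 n2 (\<lambda>z1 z2. e z1 z2 $ i)) \<and>
     E \<in> carrier_mat n2 n2 \<and>
     skew_symmetric_mat (n1 + n2 + n3) J \<and>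
     sym_pos_semidef (n1 + n2 + n3) R \<and>
     B \<in> carrier_mat (n1 + n2 + n3) m \<and>
     (\<forall>z1 \<in> carrier_vec n1. \<forall>z2 \<in> carrier_vec n2.
        transpose_mat E *\<^sub>v e z1 z2 = grad2 n2 H z1 z2)"

definition structured_system ::
  "nat \<Rightarrow> nat \<Rightarrow> nat \<Rightarrow> (real vec \<Rightarrow> real vec \<Rightarrow> real) \<Rightarrow> (real vec \<Rightarrow> real vec \<Rightarrow> real vec) \<Rightarrow>
   real mat \<Rightarrow> real mat \<Rightarrow> real mat \<Rightarrow> real mat \<Rightarrow> real set \<Rightarrow>
   (real \<Rightarrow> real vec) \<Rightarrow> (real \<Rightarrow> real vec) \<Rightarrow> (real \<Rightarrow> real vec) \<Rightarrow> (real \<Rightarrow> real vec) \<Rightarrow> bool" where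
  "structured_system n1 n2 n3 H e E J R B T z1 z2 z3 u \<longleftrightarrow>
     vec_differentiable_on z1 T \<and> vec_differentiable_on z2 T \<and>
     (\<forall>t \<in> T. grad1 n1 H (z1 t) (z2 t) @\<^sub>v (E *\<^sub>v ddt T z2 t) @\<^sub>v 0\<^sub>v n3 =
        (J - R) *\<^sub>v (ddt T z1 t @\<^sub>v e (z1 t) (z2 t) @\<^sub>v z3 t) + B *\<^sub>v u t)"

text \<open>The unknowns left after elimination of \<open>i_all\<close>, \<open>v_all\<close>, \<open>i_sol\<close>, \<open>v_str\<close>, \<open>v_foil\<close>. A
  grouping assigns each of the ten unknowns, by its position in this list, to one component.\<close>

definition remaining :: "signals \<Rightarrow> real \<Rightarrow> real vec list" where
  "remaining s t =
     [a1 s t, i_str s t, a2 s t, v_sol s t, a3 s t, e_foil s t, vec 1 (\<lambda>_. i_foil s t),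
      phi s t, j_L s t, j_V s t]"

definition component :: "nat list \<Rightarrow> signals \<Rightarrow> real \<Rightarrow> real vec" where
  "component g s t = foldr (@\<^sub>v) (map ((!) (remaining s t)) g) (0\<^sub>v 0)"

definition is_grouping :: "nat list \<Rightarrow> nat list \<Rightarrow> nat list \<Rightarrow> bool" where
  "is_grouping g1 g2 g3 \<longleftrightarrow> distinct (g1 @ g2 @ g3) \<and> set (g1 @ g2 @ g3) = {..<10}"

definition input :: "signals \<Rightarrow> real \<Rightarrow> real vec" where
  "input s t = i_src s t @\<^sub>v v_src s t"

end

(* The Hamiltonian is H = (a1.K1 a1 + a2.K2 a2 + a3.K3 a3 + phi.C' phi + jL.L jL) / 2 with
   C' = A_C C A_C^T, the components are z1 = (a1, a2, a3), z2 = (phi, jL) and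
   z3 = (i_str, v_sol, e, i_foil, jV), and e(z1, z2) = z2, E = diag(C', L). The skew part of the
   system consists of the couplings through X_str, c and the incidence matrices. Each dissipative
   block is a congruence of a positive semidefinite matrix: for the solid conductor
   [I, -X_sol]^T M2 [I, -X_sol], and for the foil conductor [I, -Y]^T M3 [I, -Y] with
   Y = pinv M3 * X_foil. The latter reproduces the foil equations because the range of X_foil is
   contained in that of M3: if M3 u = 0, then sigma w_u = 0 almost everywhere for the field w_u
   with coordinates u, whence X_foil^T u = 0. *)
theory Submission
  imports Defs "Jordan_Normal_Form.Gauss_Jordan_Elimination"
begin

section \<open>The Moore-Penrose inverse of a symmetric matrix\<close>

text \<open>Signs decide between the skew and the dissipative part. With the time derivatives of the
  potentials on the right-hand side, the stranded coupling enters its two rows as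
  \<open>X_str\<close> and minus its transpose, hence is skew. The solid and foil couplings between
  field row and terminal row enter with equal signs, so they are symmetric and must count as
  dissipation, together with the mass matrix and the conductance. Semidefiniteness is then a
  property of the whole two-by-two block and needs a completed square in the time derivative of the
  potential minus a matrix times the voltage. For the solid conductor this is immediate because
  \<open>G_sol\<close> is a congruence of \<open>M_mat\<close>. For the foil the off-diagonal block
  is \<open>X_foil\<close> itself, and the square can be completed only if \<open>X_foil\<close>
  factors through the possibly singular mass matrix; this is what the range inclusion is for. A
  second obstacle is that \<open>pinv\<close> is a definite description: existence and uniqueness
  come before any use of its equations, its symmetry or its semidefiniteness.\<close>

lemma mult_mat_assoc:
  "dim_col A = dim_row B \<Longrightarrow> dim_col B = dim_row C \<Longrightarrow> A * B * C = A * (B * C)"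
  for A B C :: "'a :: semiring_0 mat"
  by (rule assoc_mult_mat[of _ "dim_row A" "dim_row B" _ "dim_row C" _ "dim_col C"]) (auto intro: carrier_matI)

text \<open>Row reduction gives \<open>C = P * A\<close> in reduced echelon form with
  \<open>P\<close> invertible. Sending the i-th row index to the i-th pivot column defines
  \<open>H\<close> with \<open>C * H * C = C\<close>, and \<open>G = H * P\<close> pulls this back
  to \<open>A\<close>.\<close>

lemma generalized_inverse_exists:
  fixes A :: "'a :: field mat"
  assumes A: "A \<in> carrier_mat nr nc"
  shows "\<exists>G \<in> carrier_mat nc nr. A * G * A = A"
proof -
  obtain C Z where gj: "gauss_jordan A (0\<^sub>m nr 0) = (C, Z)" by (metis surj_pair)
  have C: "C \<in> carrier_mat nr nc"
    using gauss_jordan_carrier(1)[OF A zero_carrier_mat gj] .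
  obtain f where f: "pivot_fun C f nc"
    using gauss_jordan_row_echelon[OF A gj] C unfolding row_echelon_form_def by auto
  obtain P where P: "P \<in> Units (ring_mat TYPE('a) nr undefined)" and CP: "C = P * A"
    using gauss_jordan_transform[OF A zero_carrier_mat gj, of undefined] by blast
  have Pc: "P \<in> carrier_mat nr nr" using P unfolding Units_def ring_mat_def by auto
  obtain Q where Q: "Q \<in> carrier_mat nr nr" and QP: "Q * P = 1\<^sub>m nr"
    using P unfolding Units_def ring_mat_def by auto
  have dim: "dim_row C = nr" using C by simp
  note piv = pivot_funD[OF dim f]
  \<comment> \<open>A zero row \<open>i\<close> has \<open>f i = nc\<close>, which no row index of
    \<open>H\<close> attains, so column \<open>i\<close> of \<open>H\<close> vanishes and
    \<open>C * H\<close> is the projection onto the nonzero rows.\<close>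
  define H where "H = mat nc nr (\<lambda>(j, i). if j = f i then 1 else 0 :: 'a)"
  have H: "H \<in> carrier_mat nc nr" unfolding H_def by simp
  have CH: "(C * H) $$ (k, i) = (if k = i \<and> f i < nc then 1 else 0)" if "k < nr" "i < nr" for k i
  proof -
    have "(C * H) $$ (k, i) = (\<Sum>j < nc. C $$ (k, j) * (if j = f i then 1 else 0))"
      using that C H by (auto simp: scalar_prod_def H_def atLeast0LessThan intro!: sum.cong)
    also have "\<dots> = (if f i < nc then C $$ (k, f i) else 0)"
      by (simp add: sum.delta' if_distrib cong: if_cong)
    also have "\<dots> = (if k = i \<and> f i < nc then 1 else 0)"
      using piv(4,5) that by auto
    finally show ?thesis .
  qed
  have CHC: "C * H * C = C"
  proof (rule eq_matI)
    fix k j assume k: "k < dim_row C" and j: "j < dim_col C"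
    then have kn: "k < nr" and jn: "j < nc" using C by auto
    have "(C * H * C) $$ (k, j) = (\<Sum>i < nr. (C * H) $$ (k, i) * C $$ (i, j))"
      using kn jn C H
      by (auto simp: scalar_prod_def atLeast0LessThan simp del: assoc_mult_mat intro!: sum.cong)
    also have "\<dots> = (\<Sum>i < nr. if i = k then (if f k < nc then C $$ (k, j) else 0) else 0)"
      by (rule sum.cong) (auto simp: CH kn)
    also have "\<dots> = (if f k < nc then C $$ (k, j) else 0)"
      using kn by simp
    also have "\<dots> = C $$ (k, j)"
      using piv(1)[OF kn] piv(2)[OF kn, of j] jn by (cases "f k < nc") auto
    finally show "(C * H * C) $$ (k, j) = C $$ (k, j)" .
  qed (use C H in auto)
  have AQ: "A = Q * C"
    using arg_cong[OF QP, of "\<lambda>X. X * A"] A Pc Q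
    by (simp add: CP mult_mat_assoc del: assoc_mult_mat)
  have "A * (H * P) * A = A * H * C"
    unfolding CP using A H Pc by (simp add: mult_mat_assoc del: assoc_mult_mat)
  also have "\<dots> = Q * C * H * C" using AQ by (rule arg_cong)
  also have "\<dots> = Q * (C * H * C)" using Q C H by (simp add: mult_mat_assoc del: assoc_mult_mat)
  also have "\<dots> = A" unfolding CHC AQ[symmetric] ..
  finally show ?thesis using H Pc by (intro bexI[of _ "H * P"]) auto
qed

text \<open>The diagonal of \<open>transpose_mat Z * Z\<close> holds the squared Euclidean norms of
  the columns of \<open>Z\<close>.\<close>

lemma mult_transpose_self_eq_0:
  fixes Z :: "real mat"
  assumes "transpose_mat Z * Z = 0\<^sub>m n n" "Z \<in> carrier_mat m n"
  shows "Z = 0\<^sub>m m n"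
proof (rule eq_matI)
  fix i j assume ij: "i < dim_row (0\<^sub>m m n :: real mat)" "j < dim_col (0\<^sub>m m n :: real mat)"
  then have "0 = (transpose_mat Z * Z) $$ (j, j)" using assms by simp
  also have "\<dots> = (\<Sum>k<m. Z $$ (k, j) ^ 2)"
    using ij assms(2) by (auto simp: scalar_prod_def atLeast0LessThan power2_eq_square intro!: sum.cong)
  finally have "(\<Sum>k<m. Z $$ (k, j) ^ 2) = 0" by simp
  then have "Z $$ (i, j) ^ 2 = 0"
    using ij by (subst (asm) sum_nonneg_eq_0_iff) auto
  then show "Z $$ (i, j) = 0\<^sub>m m n $$ (i, j)" using ij by simp
qed (use assms in auto)

text \<open>Both \<open>A * P\<close> and \<open>A * Q\<close> are symmetric and each absorbs the
  other, so transposing a product of the two shows that they coincide; likewise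
  \<open>P * A = Q * A\<close>. Then \<open>P = P * A * P\<close> can be rewritten into
  \<open>Q * A * Q\<close> one factor at a time.\<close>

lemma moore_penrose_unique:
  assumes "is_moore_penrose A P" "is_moore_penrose A Q"
  shows "P = Q"
proof -
  define m n where "m = dim_row A" and "n = dim_col A"
  have A: "A \<in> carrier_mat m n" unfolding m_def n_def by simp
  have P: "P \<in> carrier_mat n m" and Q: "Q \<in> carrier_mat n m"
    using assms unfolding is_moore_penrose_def m_def n_def by auto
  have p: "A * P * A = A" "P * A * P = P" "transpose_mat (A * P) = A * P" "transpose_mat (P * A) = P * A"
    and q: "A * Q * A = A" "Q * A * Q = Q" "transpose_mat (A * Q) = A * Q" "transpose_mat (Q * A) = Q * A"
    using assms unfolding is_moore_penrose_def by auto
  have AP: "A * P \<in> carrier_mat m m" and AQ: "A * Q \<in> carrier_mat m m"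
    and PA: "P * A \<in> carrier_mat n n" and QA: "Q * A \<in> carrier_mat n n" using A P Q by auto
  have "A * P = (A * Q) * (A * P)"
    using A P Q arg_cong[OF q(1), of "\<lambda>X. X * P"]
    by (simp add: mult_mat_assoc del: assoc_mult_mat)
  also have "\<dots> = transpose_mat (A * P * (A * Q))"
    using transpose_mult[OF AP AQ] p q by simp
  also have "A * P * (A * Q) = A * Q"
    using A P Q arg_cong[OF p(1), of "\<lambda>X. X * Q"]
    by (simp add: mult_mat_assoc del: assoc_mult_mat)
  finally have e1: "A * P = A * Q" using q by simp
  have "P * A = (P * A) * (Q * A)"
    using A P Q arg_cong[OF q(1), of "\<lambda>X. P * X"]
    by (simp add: mult_mat_assoc del: assoc_mult_mat)
  also have "\<dots> = transpose_mat (Q * A * (P * A))"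
    using transpose_mult[OF QA PA] p q by simp
  also have "Q * A * (P * A) = Q * A"
    using A P Q arg_cong[OF p(1), of "\<lambda>X. Q * X"]
    by (simp add: mult_mat_assoc del: assoc_mult_mat)
  finally have e2: "P * A = Q * A" using q by simp
  have "P = P * A * P" using p(2) by (rule sym)
  also have "\<dots> = Q * (A * P)" unfolding e2 using A P Q by (simp add: mult_mat_assoc del: assoc_mult_mat)
  also have "\<dots> = Q * A * Q" unfolding e1 using A Q by (simp add: mult_mat_assoc del: assoc_mult_mat)
  also have "\<dots> = Q" by (rule q(2))
  finally show ?thesis .
qed

text \<open>The generalized inverse \<open>G\<close> is taken for \<open>A * A\<close>, not for
  \<open>A\<close>: a symmetric real matrix has the same range and kernel as its square, so one
  factor \<open>A\<close> can be cancelled. This makes \<open>A * G * A\<close> a two-sided identity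
  on \<open>A\<close>, and \<open>P = A * G * A * G * A\<close> is the inverse.\<close>

lemma moore_penrose_exists_symmetric:
  assumes "symmetric_mat n A"
  shows "\<exists>P. is_moore_penrose A P"
proof -
  have A: "A \<in> carrier_mat n n" and At: "transpose_mat A = A"
    using assms unfolding symmetric_mat_def by auto
  obtain G where G: "G \<in> carrier_mat n n" and BG: "A * A * G * (A * A) = A * A"
    using generalized_inverse_exists[of "A * A" n n] A by auto
  \<comment> \<open>The difference \<open>Z = Y - A\<close> lies in the range of \<open>A\<close>
    and is annihilated by \<open>A\<close>. For symmetric \<open>A\<close> range and kernel are
    orthogonal, so \<open>Z\<close> is zero.\<close>
  have cancel: "Y = A" if Y: "Y \<in> carrier_mat n n" and YA: "\<exists>W \<in> carrier_mat n n. Y = A * W"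
    and eq: "A * Y = A * A" for Y
  proof -
    obtain W where W: "W \<in> carrier_mat n n" "Y = A * W" using YA by auto
    define Z where "Z = Y - A"
    have Z: "Z \<in> carrier_mat n n" unfolding Z_def using A Y by auto
    have AZ: "A * Z = 0\<^sub>m n n"
      unfolding Z_def using A Y eq by (simp add: mult_minus_distrib_mat)
    have ZW: "Z = A * (W - 1\<^sub>m n)"
      unfolding Z_def W(2) using A W by (simp add: mult_minus_distrib_mat)
    have "transpose_mat Z = transpose_mat (W - 1\<^sub>m n) * A"
      unfolding ZW using A W(1) At by (subst transpose_mult[of _ n n]) auto
    then have "transpose_mat Z * Z = transpose_mat (W - 1\<^sub>m n) * (A * Z)"
      using assoc_mult_mat[of "transpose_mat (W - 1\<^sub>m n)" n n A n Z n] A Z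
      by (simp add: minus_carrier_mat)
    also have "\<dots> = 0\<^sub>m n n" unfolding AZ using W(1) by simp
    finally have "Z = 0\<^sub>m n n" using mult_transpose_self_eq_0 Z by blast
    then have "(Y - A) $$ (i, j) = 0" if "i < n" "j < n" for i j
      using that unfolding Z_def by simp
    then show "Y = A" using A Y by (intro eq_matI) auto
  qed
  note assoc = assoc_mult_mat[of _ n n _ n _ n]
  have e1: "A * (G * (A * A)) = A"
    using A G BG by (intro cancel) (auto simp: assoc)
  \<comment> \<open>\<open>G\<close> need not be symmetric. Its transpose is also a generalized
    inverse of \<open>A * A\<close>, so the cancellation applies to it too, and transposing the
    outcome gives the mirror image of \<open>e1\<close>.\<close>
  have "transpose_mat (A * A * G * (A * A)) = transpose_mat (A * A)" using BG by simp
  then have BG': "A * (A * (transpose_mat G * (A * A))) = A * A"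
    using A G At by (simp add: transpose_mult[of _ n n _ n] assoc)
  have "A * (transpose_mat G * (A * A)) = A"
    using A G BG' by (intro cancel) (auto simp: assoc)
  then have "transpose_mat (A * (transpose_mat G * (A * A))) = A" using At by simp
  then have e2: "A * (A * (G * A)) = A"
    using A G At by (simp add: transpose_mult[of _ n n _ n] assoc)
  \<comment> \<open>\<open>E\<close> is the orthogonal projection onto the range of
    \<open>A\<close>; its symmetry is read off from \<open>transpose_mat E * E = E\<close>.\<close>
  define E where "E = A * (G * A)"
  have E: "E \<in> carrier_mat n n" unfolding E_def using A G by auto
  have EA: "E * A = A" and AE: "A * E = A"
    using e1 e2 A G unfolding E_def by (simp_all add: assoc)
  have "transpose_mat E * A = transpose_mat (A * E)"
    using A E At by (simp add: transpose_mult[of _ n n _ n])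
  then have EtA: "transpose_mat E * A = A" using AE At by simp
  have "transpose_mat E * E = transpose_mat E * A * (G * A)"
    using A G E by (subst (2) E_def) (simp add: mult_mat_assoc del: assoc_mult_mat)
  then have EtE: "transpose_mat E * E = E" unfolding EtA by (simp only: E_def)
  have "transpose_mat (transpose_mat E * E) = transpose_mat E * E"
    using E by (simp add: transpose_mult[of _ n n _ n])
  then have Et: "transpose_mat E = E" unfolding EtE .
  define P where "P = A * (G * (A * (G * A)))"
  have P: "P \<in> carrier_mat n n" unfolding P_def using A G by auto
  have AP: "A * P = E" and PA: "P * A = E"
    using e1 arg_cong[OF e2, of "\<lambda>X. X * (G * A)"] A G unfolding P_def E_def by (simp_all add: assoc)
  have "E * P = P" 
    using arg_cong[OF EA, of "\<lambda>X. X * (G * (A * (G * A)))"] A G E unfolding P_def by (simp add: assoc)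
  then have "is_moore_penrose A P"
    unfolding is_moore_penrose_def using A P AP PA Et EA by auto
  then show ?thesis ..
qed

lemma pinv_symmetric:
  assumes "symmetric_mat n A"
  shows "is_moore_penrose A (pinv A)"
  unfolding pinv_def
  by (rule theI') (use moore_penrose_exists_symmetric[OF assms] moore_penrose_unique in blast)

text \<open>The Penrose equations are stable under transposition of both matrices, so the transpose
  of \<open>pinv A\<close> is again an inverse of \<open>A\<close>, and uniqueness identifies the
  two.\<close>

lemma symmetric_mat_pinv:
  assumes A: "symmetric_mat n A"
  shows "symmetric_mat n (pinv A)"
proof -
  have Ac: "A \<in> carrier_mat n n" and At: "transpose_mat A = A"
    using A unfolding symmetric_mat_def by auto
  let ?P = "pinv A" and ?Q = "transpose_mat (pinv A)"
  have mp: "A * ?P * A = A" "?P * A * ?P = ?P" "transpose_mat (A * ?P) = A * ?P"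
    "transpose_mat (?P * A) = ?P * A" and P: "?P \<in> carrier_mat n n"
    using pinv_symmetric[OF A] Ac unfolding is_moore_penrose_def by auto
  have Q: "?Q \<in> carrier_mat n n" using P by simp
  have AQ: "A * ?Q = ?P * A"
    using transpose_mult[OF P Ac] unfolding At mp by (rule sym)
  have QA: "?Q * A = A * ?P"
    using transpose_mult[OF Ac P] unfolding At mp by (rule sym)
  have "is_moore_penrose A ?Q"
    unfolding is_moore_penrose_def
  proof (intro conjI)
    show "?Q \<in> carrier_mat (dim_col A) (dim_row A)" using Q Ac by simp
    have "A * ?Q * A = A * (?Q * A)" using Ac Q by (simp add: mult_mat_assoc del: assoc_mult_mat)
    also have "\<dots> = transpose_mat (A * ?P * A)"
      unfolding transpose_mult[OF mult_carrier_mat[OF Ac P] Ac] At mp(3) QA ..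
    finally show "A * ?Q * A = A" unfolding mp(1) At .
    have "?Q * A * ?Q = ?Q * (A * ?Q)" using Ac Q by (simp add: mult_mat_assoc del: assoc_mult_mat)
    also have "\<dots> = transpose_mat (?P * A * ?P)"
      unfolding transpose_mult[OF mult_carrier_mat[OF P Ac] P] mp(4) AQ ..
    finally show "?Q * A * ?Q = ?Q" unfolding mp(2) .
    show "transpose_mat (A * ?Q) = A * ?Q" unfolding AQ by (rule mp(4))
    show "transpose_mat (?Q * A) = ?Q * A" unfolding QA by (rule mp(3))
  qed
  then have "?Q = ?P" using pinv_symmetric[OF A] by (rule moore_penrose_unique)
  then show ?thesis using P unfolding symmetric_mat_def by simp
qed

lemma sym_pos_semidef_congruence:
  assumes M: "sym_pos_semidef m M" and X: "X \<in> carrier_mat m n"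
  shows "sym_pos_semidef n (transpose_mat X * M * X)"
proof -
  have Mc: "M \<in> carrier_mat m m" and Mt: "transpose_mat M = M"
    using M unfolding sym_pos_semidef_def symmetric_mat_def by auto
  have "0 \<le> x \<bullet> (transpose_mat X * M * X *\<^sub>v x)" if x: "x \<in> carrier_vec n" for x
  proof -
    have "transpose_mat X * M * X *\<^sub>v x = transpose_mat X *\<^sub>v (M *\<^sub>v (X *\<^sub>v x))"
      using Mc X x by (simp add: assoc_mult_mat_vec[of _ n m _ n] assoc_mult_mat_vec[of _ n m _ m])
    then have "x \<bullet> (transpose_mat X * M * X *\<^sub>v x) = (X *\<^sub>v x) \<bullet> (M *\<^sub>v (X *\<^sub>v x))"
      using transpose_vec_mult_scalar[OF X x, of "M *\<^sub>v (X *\<^sub>v x)"] Mc X x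
        comm_scalar_prod[of x n "transpose_mat X *\<^sub>v (M *\<^sub>v (X *\<^sub>v x))"]
        comm_scalar_prod[of "X *\<^sub>v x" m "M *\<^sub>v (X *\<^sub>v x)"] by auto
    also have "\<dots> \<ge> 0" using M X x unfolding sym_pos_semidef_def by auto
    finally show ?thesis .
  qed
  moreover have "transpose_mat (transpose_mat X * M * X) = transpose_mat X * M * X"
    using Mc X Mt
    by (simp add: transpose_mult[of "transpose_mat X" n m "M * X" n] transpose_mult[of M m m X n]
        assoc_mult_mat[of _ n m _ m _ n])
  ultimately show ?thesis
    using Mc X unfolding sym_pos_semidef_def symmetric_mat_def by auto
qed

text \<open>By symmetry the second Penrose equation exhibits \<open>pinv A\<close> as a congruence
  of \<open>A\<close>.\<close>

lemma sym_pos_semidef_pinv: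
  assumes "sym_pos_semidef n A"
  shows "sym_pos_semidef n (pinv A)"
proof -
  have A: "symmetric_mat n A" using assms unfolding sym_pos_semidef_def by auto
  have P: "pinv A \<in> carrier_mat n n" "transpose_mat (pinv A) = pinv A"
    using symmetric_mat_pinv[OF A] unfolding symmetric_mat_def by auto
  have "transpose_mat (pinv A) * A * pinv A = pinv A"
    using pinv_symmetric[OF A] P unfolding is_moore_penrose_def by simp
  then show ?thesis using sym_pos_semidef_congruence[OF assms P(1)] by simp
qed

section \<open>Field matrices\<close>

lemma mult_mat_vec_unit:
  fixes A :: "'a :: semiring_1 mat"
  assumes "A \<in> carrier_mat m n" "i < m" "j < n"
  shows "(A *\<^sub>v unit_vec n j) $ i = A $$ (i, j)"
  using assms by (simp add: scalar_prod_right_unit)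

lemma quadratic_form_expand:
  fixes A :: "'a :: comm_semiring_0 mat"
  assumes "A \<in> carrier_mat n n" "x \<in> carrier_vec n" "y \<in> carrier_vec n"
  shows "x \<bullet> (A *\<^sub>v y) = (\<Sum>i<n. \<Sum>j<n. x $ i * (y $ j * A $$ (i, j)))"
  using assms
  by (auto simp: scalar_prod_def sum_distrib_left atLeast0LessThan mult_ac intro!: sum.cong)

text \<open>By Cauchy-Schwarz the integrand is dominated by \<open>C\<close> times the sum of the
  two squared norms. Integrability matters because the integral of a non-integrable function is 0 by
  convention, and linearity of the integral fails for such functions.\<close>

lemma integrable_weighted_inner:
  fixes f g :: "real ^ 3 \<Rightarrow> real ^ 3"
  assumes "L2_field S f" "L2_field S g"
    and s: "s \<in> borel_measurable (lebesgue_on S)" and bnd: "\<And>x. \<bar>s x\<bar> \<le> C"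
  shows "integrable (lebesgue_on S) (\<lambda>x. s x * inner (f x) (g x))"
proof -
  have f: "f \<in> borel_measurable (lebesgue_on S)" "integrable (lebesgue_on S) (\<lambda>x. (norm (f x))\<^sup>2)"
    and g: "g \<in> borel_measurable (lebesgue_on S)" "integrable (lebesgue_on S) (\<lambda>x. (norm (g x))\<^sup>2)"
    using assms unfolding L2_field_def by auto
  have C: "0 \<le> C" using bnd[of 0] by linarith
  show ?thesis
  proof (rule Bochner_Integration.integrable_bound)
    show "integrable (lebesgue_on S) (\<lambda>x. C * ((norm (f x))\<^sup>2 + (norm (g x))\<^sup>2))"
      using f g by auto
    show "(\<lambda>x. s x * inner (f x) (g x)) \<in> borel_measurable (lebesgue_on S)"
      using f g s by measurable
    show "AE x in lebesgue_on S. norm (s x * inner (f x) (g x))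
        \<le> norm (C * ((norm (f x))\<^sup>2 + (norm (g x))\<^sup>2))"
    proof (rule AE_I2)
      fix x
      have "\<bar>inner (f x) (g x)\<bar> \<le> norm (f x) * norm (g x)" by (rule Cauchy_Schwarz_ineq2)
      also have "\<dots> \<le> (norm (f x))\<^sup>2 + (norm (g x))\<^sup>2"
        using sum_squares_bound[of "norm (f x)" "norm (g x)"]
          mult_nonneg_nonneg[OF norm_ge_zero norm_ge_zero, of "f x" "g x"] by linarith
      finally have "\<bar>s x\<bar> * \<bar>inner (f x) (g x)\<bar> \<le> C * ((norm (f x))\<^sup>2 + (norm (g x))\<^sup>2)"
        using bnd[of x] C by (intro mult_mono) auto
      then show "norm (s x * inner (f x) (g x)) \<le> norm (C * ((norm (f x))\<^sup>2 + (norm (g x))\<^sup>2))"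
        using C by (simp add: abs_mult)
    qed
  qed
qed

text \<open>The weight \<open>s\<close> is arbitrary because two cases are needed: a bounded
  conductivity for mass matrices, and conductivity times a scalar shape function for
  \<open>X_foil\<close>, which may be unbounded and whose integrability is part of
  \<open>valid_foil\<close>.\<close>

lemma sum_lin_comb_integral:
  assumes "\<And>i j. i < n_w F \<Longrightarrow> j < n_w F \<Longrightarrow>
    integrable M (\<lambda>z. s z * inner (edge_fun F j z) (edge_fun F i z))"
  shows "(\<Sum>i<n_w F. \<Sum>j<n_w F. x $ i * (y $ j *
      (LINT z|M. s z * inner (edge_fun F j z) (edge_fun F i z)))) =
    (LINT z|M. s z * inner (lin_comb F y z) (lin_comb F x z))"
    and "integrable M (\<lambda>z. s z * inner (lin_comb F y z) (lin_comb F x z))"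
proof -
  have eq: "s z * inner (lin_comb F y z) (lin_comb F x z) =
      (\<Sum>i<n_w F. \<Sum>j<n_w F. x $ i * (y $ j * (s z * inner (edge_fun F j z) (edge_fun F i z))))" for z
    unfolding lin_comb_def inner_sum_left inner_sum_right sum_distrib_left
    by (simp add: mult_ac)
  show "integrable M (\<lambda>z. s z * inner (lin_comb F y z) (lin_comb F x z))"
    unfolding eq using assms by (intro Bochner_Integration.integrable_sum) auto
  show "(\<Sum>i<n_w F. \<Sum>j<n_w F. x $ i * (y $ j *
      (LINT z|M. s z * inner (edge_fun F j z) (edge_fun F i z)))) =
    (LINT z|M. s z * inner (lin_comb F y z) (lin_comb F x z))"
  proof -
    have int: "integrable M (\<lambda>z. x $ i * (y $ j * (s z * inner (edge_fun F j z) (edge_fun F i z))))"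
      if "i < n_w F" "j < n_w F" for i j using assms[OF that] by simp
    have "(LINT z|M. s z * inner (lin_comb F y z) (lin_comb F x z)) = (\<Sum>i<n_w F. LINT z|M.
        (\<Sum>j<n_w F. x $ i * (y $ j * (s z * inner (edge_fun F j z) (edge_fun F i z)))))"
      unfolding eq using int
      by (intro Bochner_Integration.integral_sum Bochner_Integration.integrable_sum) auto
    also have "\<dots> = (\<Sum>i<n_w F. \<Sum>j<n_w F.
        LINT z|M. x $ i * (y $ j * (s z * inner (edge_fun F j z) (edge_fun F i z))))"
      using int by (intro sum.cong Bochner_Integration.integral_sum) auto
    finally show ?thesis by simp
  qed
qed

lemma mass_mat_carrier [simp]: "mass_mat F s \<in> carrier_mat (n_w F) (n_w F)"
  unfolding mass_mat_def by simp

lemma symmetric_mat_mass_mat: "symmetric_mat (n_w F) (mass_mat F s)"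
  unfolding symmetric_mat_def mass_mat_def by (auto simp: inner_commute)

lemma symmetric_mat_K_mat: "symmetric_mat (n_w F) (K_mat F)"
  unfolding symmetric_mat_def K_mat_def by (auto simp: inner_commute)

lemma valid_field_model_L2:
  "valid_field_model F \<Longrightarrow> i < n_w F \<Longrightarrow> L2_field (dom F) (edge_fun F i)"
  unfolding valid_field_model_def Hcurl_def by auto

text \<open>The mass matrix is the Gram matrix of a weighted L2 product. The integrability statement
  is what later turns a vanishing integral of a nonnegative function into vanishing almost
  everywhere.\<close>

lemma mass_mat_quadratic_form:
  assumes F: "valid_field_model F" and s: "s \<in> borel_measurable (lebesgue_on (dom F))"
    and bnd: "\<And>x. \<bar>s x\<bar> \<le> C"
    and x: "x \<in> carrier_vec (n_w F)" and y: "y \<in> carrier_vec (n_w F)"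
  shows "x \<bullet> (mass_mat F s *\<^sub>v y) =
      (LINT z|lebesgue_on (dom F). s z * inner (lin_comb F y z) (lin_comb F x z))"
    and "integrable (lebesgue_on (dom F)) (\<lambda>z. s z * inner (lin_comb F y z) (lin_comb F x z))"
proof -
  have int: "integrable (lebesgue_on (dom F)) (\<lambda>z. s z * inner (edge_fun F j z) (edge_fun F i z))"
    if "i < n_w F" "j < n_w F" for i j
    using that valid_field_model_L2[OF F] s bnd by (intro integrable_weighted_inner) auto
  show "integrable (lebesgue_on (dom F)) (\<lambda>z. s z * inner (lin_comb F y z) (lin_comb F x z))"
    using int by (rule sum_lin_comb_integral(2))
  show "x \<bullet> (mass_mat F s *\<^sub>v y) =
      (LINT z|lebesgue_on (dom F). s z * inner (lin_comb F y z) (lin_comb F x z))"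
    unfolding quadratic_form_expand[OF mass_mat_carrier x y]
    by (subst sum_lin_comb_integral(1)[symmetric, OF int]) (auto simp: mass_mat_def intro!: sum.cong)
qed

lemma sym_pos_semidef_mass_mat:
  assumes "valid_field_model F" "s \<in> borel_measurable (lebesgue_on (dom F))"
    and "\<And>x. 0 \<le> s x" "\<And>x. s x \<le> C"
  shows "sym_pos_semidef (n_w F) (mass_mat F s)"
  unfolding sym_pos_semidef_def
proof (intro conjI symmetric_mat_mass_mat ballI)
  fix x :: "real vec" assume x: "x \<in> carrier_vec (n_w F)"
  show "0 \<le> x \<bullet> (mass_mat F s *\<^sub>v x)"
    using assms by (subst mass_mat_quadratic_form(1)[OF assms(1,2) _ x x, of C]) auto
qed

lemma borel_measurable_open_step:
  fixes c :: real
  assumes "open S" "open D"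
  shows "(\<lambda>x. if x \<in> D then c else 0) \<in> borel_measurable (lebesgue_on S)"
proof -
  have "(\<lambda>x. if x \<in> D then c else 0) \<in> borel_measurable lebesgue"
    using assms by (intro measurable_If_set) auto
  then show ?thesis by (rule measurable_restrict_space1)
qed

lemma valid_field_model_open: "valid_field_model F \<Longrightarrow> open (dom F)"
  unfolding valid_field_model_def lipschitz_domain_def by auto

lemma sigma_measurable_nonneg_bounded:
  assumes "valid_field_model F"
  shows "sigma F \<in> borel_measurable (lebesgue_on (dom F))" "0 \<le> sigma F x" "sigma F x \<le> conduct F"
    "\<bar>sigma F x\<bar> \<le> conduct F"
  using borel_measurable_open_step[OF valid_field_model_open[OF assms], of "dom_c F" "conduct F"] assms
  unfolding sigma_def[abs_def] valid_field_model_def by auto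

lemma sym_pos_semidef_M_mat:
  assumes "valid_field_model F"
  shows "sym_pos_semidef (n_w F) (M_mat F)"
  unfolding M_mat_def using sigma_measurable_nonneg_bounded[OF assms]
  by (intro sym_pos_semidef_mass_mat assms) auto

lemma sym_pos_semidef_M_str:
  assumes F: "valid_field_model F" and S: "valid_stranded F S"
  shows "sym_pos_semidef (n_w F) (M_str F S)"
  unfolding M_str_def
proof (rule sym_pos_semidef_mass_mat[OF F, of _ "sigma_str S"])
  have "open (\<Union>k < n_str S. str_dom S k)"
    using S unfolding valid_stranded_def by auto
  then show "(\<lambda>x. if x \<in> (\<Union>k < n_str S. str_dom S k) then sigma_str S else 0)
      \<in> borel_measurable (lebesgue_on (dom F))"
    by (rule borel_measurable_open_step[OF valid_field_model_open[OF F]])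
qed (use S in \<open>auto simp: valid_stranded_def\<close>)

lemma sym_pos_semidef_R_str:
  assumes "valid_field_model F" "valid_stranded F S"
  shows "sym_pos_semidef (n_str S) (R_str F S)"
  unfolding R_str_def
  using sym_pos_semidef_congruence[OF sym_pos_semidef_pinv[OF sym_pos_semidef_M_str[OF assms]]]
  by (simp add: X_str_def)

lemma X_foil_carrier [simp]: "X_foil F S \<in> carrier_mat (n_w F) (n_p S)"
  unfolding X_foil_def by simp

lemma X_foil_transpose_kernel:
  assumes F: "valid_field_model F" and S: "valid_foil F S"
    and u: "u \<in> carrier_vec (n_w F)" and Mu: "M_mat F *\<^sub>v u = 0\<^sub>v (n_w F)"
  shows "transpose_mat (X_foil F S) *\<^sub>v u = 0\<^sub>v (n_p S)"
proof (rule eq_vecI)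
  note sig = sigma_measurable_nonneg_bounded[OF F]
  note form = mass_mat_quadratic_form[OF F sig(1) sig(4) u u]
  have "(LINT z|lebesgue_on (dom F). sigma F z * inner (lin_comb F u z) (lin_comb F u z)) = 0"
    using form(1) Mu u unfolding M_mat_def by simp
  then have "AE z in lebesgue_on (dom F). sigma F z * inner (lin_comb F u z) (lin_comb F u z) = 0"
    using form(2) sig(2) by (subst (asm) integral_nonneg_eq_0_iff_AE) auto
  then have ae: "AE z in lebesgue_on (dom F). sigma F z = 0 \<or> lin_comb F u z = 0"
    by eventually_elim auto
  fix l assume "l < dim_vec (0\<^sub>v (n_p S) :: real vec)"
  then have l: "l < n_p S" by simp
  have int: "integrable (lebesgue_on (dom F))
      (\<lambda>z. sigma F z * p_fun S l z * inner (edge_fun F j z) (edge_fun F i z))"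
    if "i < n_w F" "j < n_w F" for i j
    using S l that unfolding valid_foil_def by auto
  \<comment> \<open>Entry \<open>l\<close> is the integral of \<open>sigma F z * p_fun S l z\<close>
    times the inner product of the distribution field and the field of \<open>u\<close>. The
    integrand vanishes wherever \<open>sigma F\<close> or the field of \<open>u\<close> does,
    regardless of the sign of \<open>p_fun\<close>.\<close>
  have "(transpose_mat (X_foil F S) *\<^sub>v u) $ l =
      (\<Sum>i<n_w F. \<Sum>j<n_w F. u $ i * (x_foil S $ j * (LINT z|lebesgue_on (dom F).
        sigma F z * p_fun S l z * inner (edge_fun F j z) (edge_fun F i z))))"
    using u l unfolding X_foil_def
    by (auto simp: scalar_prod_def sum_distrib_left sum_distrib_right atLeast0LessThan mult_ac
        intro!: sum.cong)
  also have "\<dots> = (LINT z|lebesgue_on (dom F).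
      sigma F z * p_fun S l z * inner (lin_comb F (x_foil S) z) (lin_comb F u z))"
    by (rule sum_lin_comb_integral(1)[OF int])
  also have "\<dots> = 0"
    by (rule integral_eq_zero_AE) (use ae in \<open>eventually_elim, auto\<close>)
  finally show "(transpose_mat (X_foil F S) *\<^sub>v u) $ l = 0\<^sub>v (n_p S) $ l" using l by simp
qed (simp add: X_foil_def)

text \<open>The kernel of \<open>M\<close> lies in that of the transpose of \<open>X_foil\<close>, so the range of \<open>X_foil\<close> lies
  in that of the symmetric matrix \<open>M\<close>, on which \<open>M * pinv M\<close> is the identity.\<close>

lemma M_pinv_X_foil:
  assumes F: "valid_field_model F" and S: "valid_foil F S"
  shows "M_mat F * (pinv (M_mat F) * X_foil F S) = X_foil F S"
proof -
  let ?n = "n_w F" and ?M = "M_mat F" and ?X = "X_foil F S"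
  define P where "P = pinv ?M"
  have sym: "symmetric_mat ?n ?M" unfolding M_mat_def by (rule symmetric_mat_mass_mat)
  then have M: "?M \<in> carrier_mat ?n ?n" "transpose_mat ?M = ?M" unfolding symmetric_mat_def by auto
  have P: "P \<in> carrier_mat ?n ?n"
    using symmetric_mat_pinv[OF sym] unfolding P_def symmetric_mat_def by auto
  have MPM: "?M * P * ?M = ?M" and MPt: "transpose_mat (?M * P) = ?M * P"
    using pinv_symmetric[OF sym] unfolding P_def is_moore_penrose_def by auto
  have X: "?X \<in> carrier_mat ?n (n_p S)" by simp
  have MP: "?M * P \<in> carrier_mat ?n ?n" using M P by simp
  have "transpose_mat (?M * P * ?M) = ?M" using MPM M(2) by simp
  then have MMP: "?M * (?M * P) = ?M"
    using transpose_mult[OF MP M(1)] MPt M(2) by simp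
  \<comment> \<open>Since \<open>?M * (?M * P) = ?M\<close>, the vector
    \<open>v - (?M * P) *\<^sub>v v\<close> is in the kernel of \<open>?M\<close>. For all
    \<open>v\<close> together this says that \<open>transpose_mat ?X\<close> is unchanged by right
    multiplication with the symmetric \<open>?M * P\<close>; transposing finishes the proof.\<close>
  have "transpose_mat ?X *\<^sub>v (v - (?M * P) *\<^sub>v v) = 0\<^sub>v (n_p S)" if v: "v \<in> carrier_vec ?n" for v
  proof (rule X_foil_transpose_kernel[OF F S])
    show "v - (?M * P) *\<^sub>v v \<in> carrier_vec ?n" using v MP by auto
    have "?M *\<^sub>v (v - (?M * P) *\<^sub>v v) = ?M *\<^sub>v v - (?M * (?M * P)) *\<^sub>v v"
      using v M MP by (subst mult_minus_distrib_mat_vec) (auto simp del: assoc_mult_mat)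
    then show "?M *\<^sub>v (v - (?M * P) *\<^sub>v v) = 0\<^sub>v ?n"
      unfolding MMP using v M by simp
  qed
  then have ker: "transpose_mat ?X *\<^sub>v v = (transpose_mat ?X * (?M * P)) *\<^sub>v v"
    if v: "v \<in> carrier_vec ?n" for v
  proof -
    have c: "transpose_mat ?X *\<^sub>v v \<in> carrier_vec (n_p S)"
      "(transpose_mat ?X * (?M * P)) *\<^sub>v v \<in> carrier_vec (n_p S)" using P by (auto intro!: carrier_vecI simp: X_foil_def)
    have "0\<^sub>v (n_p S) = transpose_mat ?X *\<^sub>v v - (transpose_mat ?X * (?M * P)) *\<^sub>v v"
      using \<open>\<And>v. v \<in> carrier_vec ?n \<Longrightarrow> transpose_mat ?X *\<^sub>v (v - (?M * P) *\<^sub>v v) = 0\<^sub>v (n_p S)\<close>[OF v]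
        v MP by (simp add: mult_minus_distrib_mat_vec[of _ "n_p S" ?n] assoc_mult_mat_vec[of _ "n_p S" ?n _ ?n] del: assoc_mult_mat)
    then have "(transpose_mat ?X *\<^sub>v v) $ i = ((transpose_mat ?X * (?M * P)) *\<^sub>v v) $ i"
      if "i < n_p S" for i using that c
      by (metis carrier_vecD eq_iff_diff_eq_0 index_minus_vec(1) index_zero_vec(1))
    then show ?thesis using carrier_vecD[OF c(1)] carrier_vecD[OF c(2)] by (intro eq_vecI) (simp_all only:)
  qed
  have "transpose_mat ?X = transpose_mat ?X * (?M * P)"
  proof (rule eq_matI)
    fix i j assume "i < dim_row (transpose_mat ?X * (?M * P))" "j < dim_col (transpose_mat ?X * (?M * P))"
    then have ij: "i < n_p S" "j < ?n" using P by (auto simp: X_foil_def)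
    have c: "transpose_mat ?X \<in> carrier_mat (n_p S) ?n"
      "transpose_mat ?X * (?M * P) \<in> carrier_mat (n_p S) ?n"
      using X mult_carrier_mat[OF _ MP] by auto
    show "transpose_mat ?X $$ (i, j) = (transpose_mat ?X * (?M * P)) $$ (i, j)"
      using arg_cong[OF ker[OF unit_vec_carrier[of ?n j]], of "\<lambda>v. v $ i"]
      unfolding mult_mat_vec_unit[OF c(1) ij] mult_mat_vec_unit[OF c(2) ij] .
  qed (use P in \<open>auto simp: X_foil_def\<close>)
  then have "transpose_mat (transpose_mat ?X) = transpose_mat (transpose_mat ?X * (?M * P))" by simp
  then have "?X = ?M * P * ?X"
    using transpose_mult[of "transpose_mat ?X" "n_p S" ?n "?M * P" ?n] MP MPt X by simp
  then show ?thesis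
    unfolding P_def[symmetric] using M P X by simp
qed

section \<open>Block vectors and block operators\<close>

definition vec_concat :: "'a :: zero vec list \<Rightarrow> 'a vec" where
  "vec_concat xs = foldr (@\<^sub>v) xs (0\<^sub>v 0)"

fun vec_split :: "nat list \<Rightarrow> 'a :: zero vec \<Rightarrow> 'a vec list" where
  "vec_split [] z = []"
| "vec_split (d # ds) z = vec_first z d # vec_split ds (vec_last z (sum_list ds))"

abbreviation dims :: "'a vec list \<Rightarrow> nat list" where
  "dims xs \<equiv> map dim_vec xs"

text \<open>This is the Euclidean product of the concatenated vectors, kept blockwise. As
  \<open>map2\<close> truncates, that reading presupposes lists with equal
  \<open>dims\<close>.\<close>

definition block_prod :: "'a :: comm_ring_1 vec list \<Rightarrow> 'a vec list \<Rightarrow> 'a" where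
  "block_prod xs ys = sum_list (map2 (\<bullet>) xs ys)"

lemma block_prod_simps [simp]:
  "block_prod [] [] = 0" "block_prod (x # xs) (y # ys) = x \<bullet> y + block_prod xs ys"
  unfolding block_prod_def by auto

lemma vec_concat_simps [simp]:
  "vec_concat [] = 0\<^sub>v 0" "vec_concat (x # xs) = x @\<^sub>v vec_concat xs"
  unfolding vec_concat_def by auto

lemma append_vec_assoc: "(x @\<^sub>v y) @\<^sub>v z = x @\<^sub>v (y @\<^sub>v z)"
  by (rule eq_vecI) (auto simp: add.assoc)

lemma append_vec_empty [simp]: "x @\<^sub>v 0\<^sub>v 0 = x" "0\<^sub>v 0 @\<^sub>v x = x"
  by (rule eq_vecI; auto)+

lemma vec_concat_append: "vec_concat (xs @ ys) = vec_concat xs @\<^sub>v vec_concat ys"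
  by (induction xs) (auto simp: append_vec_assoc)

lemma dim_vec_concat [simp]: "dim_vec (vec_concat xs) = sum_list (dims xs)"
  by (induction xs) auto

lemma vec_concat_carrier: "dims xs = ds \<Longrightarrow> vec_concat xs \<in> carrier_vec (sum_list ds)"
  by (intro carrier_vecI) auto

lemma dims_vec_split [simp]: "dims (vec_split ds z) = ds"
  by (induction ds z rule: vec_split.induct) auto

lemma vec_concat_split: "z \<in> carrier_vec (sum_list ds) \<Longrightarrow> vec_concat (vec_split ds z) = z"
  by (induction ds z rule: vec_split.induct) auto

lemma vec_concat_eq_iff:
  assumes "dims xs = dims ys"
  shows "vec_concat xs = vec_concat ys \<longleftrightarrow> xs = ys"
  using assms
proof (induction xs arbitrary: ys)
  case (Cons x xs)
  then obtain y ys' where ys: "ys = y # ys'" "dim_vec x = dim_vec y" "dims xs = dims ys'" by auto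
  then have "x \<in> carrier_vec (dim_vec y)" "y \<in> carrier_vec (dim_vec y)" by (auto intro: carrier_vecI)
  then have "x @\<^sub>v vec_concat xs = y @\<^sub>v vec_concat ys' \<longleftrightarrow> x = y \<and> vec_concat xs = vec_concat ys'"
    by (rule append_vec_eq)
  then show ?case unfolding ys(1) using Cons.IH[OF ys(3)] by (simp only: vec_concat_simps list.inject)
qed auto

lemma vec_concat_scalar_prod:
  assumes "dims xs = dims ys"
  shows "vec_concat xs \<bullet> vec_concat ys = block_prod xs ys"
  using assms
proof (induction xs arbitrary: ys)
  case (Cons x xs)
  then obtain y ys' where ys: "ys = y # ys'" "dim_vec x = dim_vec y" "dims xs = dims ys'" by auto
  have "(x @\<^sub>v vec_concat xs) \<bullet> (y @\<^sub>v vec_concat ys') = x \<bullet> y + vec_concat xs \<bullet> vec_concat ys'"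
    using ys by (intro scalar_prod_append[of _ "dim_vec y" _ "sum_list (dims ys')"]) (auto intro!: carrier_vecI)
  then show ?case using Cons.IH[OF ys(3)] unfolding ys(1) by simp
qed (auto simp: scalar_prod_def)

lemma append_vec_diff:
  fixes x y :: "'a :: group_add vec"
  shows "dim_vec x = dim_vec x' \<Longrightarrow> dim_vec y = dim_vec y' \<Longrightarrow>
    (x @\<^sub>v y) - (x' @\<^sub>v y') = (x - x') @\<^sub>v (y - y')"
  by (rule eq_vecI) auto

lemma append_vec_plus:
  fixes x y :: "'a :: monoid_add vec"
  shows "dim_vec x = dim_vec x' \<Longrightarrow> dim_vec y = dim_vec y' \<Longrightarrow>
    (x @\<^sub>v y) + (x' @\<^sub>v y') = (x + x') @\<^sub>v (y + y')"
  by (rule eq_vecI) auto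

section \<open>Matrices of maps between block vectors\<close>

text \<open>Column \<open>j\<close> is the image of the j-th unit vector. A large block matrix can
  thus be given by its row formulas, and skewness, symmetry and semidefiniteness become identities
  of \<open>block_prod\<close> without index arithmetic.\<close>

definition op_mat :: "nat list \<Rightarrow> nat list \<Rightarrow> (real vec list \<Rightarrow> real vec list) \<Rightarrow> real mat" where
  "op_mat es ds f = mat (sum_list es) (sum_list ds)
     (\<lambda>(i, j). vec_concat (f (vec_split ds (unit_vec (sum_list ds) j))) $ i)"

lemma op_mat_carrier [simp]: "op_mat es ds f \<in> carrier_mat (sum_list es) (sum_list ds)"
  unfolding op_mat_def by simp

text \<open>No linearity is assumed: a map possessing an adjoint is linear.\<close>

lemma op_mat_mult:
  assumes f: "\<And>ys. dims ys = ds \<Longrightarrow> dims (f ys) = es"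
    and g: "\<And>xs. dims xs = es \<Longrightarrow> dims (g xs) = ds"
    and adj: "\<And>xs ys. dims xs = es \<Longrightarrow> dims ys = ds \<Longrightarrow> block_prod xs (f ys) = block_prod (g xs) ys"
    and ys: "dims ys = ds"
  shows "op_mat es ds f *\<^sub>v vec_concat ys = vec_concat (f ys)"
proof (rule eq_vecI)
  fix i assume "i < dim_vec (vec_concat (f ys))"
  then have i: "i < sum_list es" using f ys by simp
  let ?n = "sum_list ds" and ?m = "sum_list es"
  let ?e = "vec_split es (unit_vec ?m i)"
  have e: "vec_concat ?e = unit_vec ?m i" by (intro vec_concat_split) simp
  have gc: "vec_concat (g ?e) \<in> carrier_vec ?n" using g by (intro vec_concat_carrier) simp
  \<comment> \<open>Moving \<open>f\<close> across the product shows that component \<open>i\<close>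
    of \<open>f zs\<close> is the product of \<open>zs\<close> with a fixed vector, the adjoint
    applied to the i-th unit vector. That vector is row \<open>i\<close> of the matrix.\<close>
  have entry: "vec_concat (f zs) $ i = vec_concat (g ?e) \<bullet> vec_concat zs" if zs: "dims zs = ds" for zs
  proof -
    have "vec_concat (f zs) $ i = vec_concat ?e \<bullet> vec_concat (f zs)"
      unfolding e using i f[OF zs] by (subst scalar_prod_left_unit) (auto intro!: vec_concat_carrier)
    also have "\<dots> = block_prod ?e (f zs)" using f[OF zs] by (intro vec_concat_scalar_prod) simp
    also have "\<dots> = block_prod (g ?e) zs" using zs by (intro adj) auto
    also have "\<dots> = vec_concat (g ?e) \<bullet> vec_concat zs"
      using g zs by (intro vec_concat_scalar_prod[symmetric]) simp
    finally show ?thesis .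
  qed
  have row: "row (op_mat es ds f) i = vec_concat (g ?e)"
  proof (rule eq_vecI)
    fix j assume "j < dim_vec (vec_concat (g ?e))"
    then have j: "j < ?n" using carrier_vecD[OF gc] by (simp only:)
    have "row (op_mat es ds f) i $ j = vec_concat (f (vec_split ds (unit_vec ?n j))) $ i"
      using i j unfolding op_mat_def by simp
    also have "\<dots> = vec_concat (g ?e) \<bullet> unit_vec ?n j"
      by (subst entry) (auto simp: vec_concat_split)
    also have "\<dots> = vec_concat (g ?e) $ j" using j gc by simp
    finally show "row (op_mat es ds f) i $ j = vec_concat (g ?e) $ j" .
  qed (use carrier_vecD[OF gc] in \<open>simp add: op_mat_def del: dim_vec_concat\<close>)
  show "(op_mat es ds f *\<^sub>v vec_concat ys) $ i = vec_concat (f ys) $ i"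
    using entry[OF ys] row i by (simp add: op_mat_def)
qed (use f ys in \<open>simp add: op_mat_def\<close>)

text \<open>Entry \<open>(i, j)\<close> is \<open>block_prod\<close> of the i-th unit vector with
  the image of the j-th. The factor \<open>c\<close> covers the skew case (\<open>c = - 1\<close>)
  and the symmetric case (\<open>c = 1\<close>) at once.\<close>

lemma op_mat_transpose:
  assumes f: "\<And>ys. dims ys = ds \<Longrightarrow> dims (f ys) = ds"
    and adj: "\<And>xs ys. dims xs = ds \<Longrightarrow> dims ys = ds \<Longrightarrow> block_prod xs (f ys) = c * block_prod ys (f xs)"
  shows "op_mat ds ds f = c \<cdot>\<^sub>m transpose_mat (op_mat ds ds f)"
proof (rule eq_matI)
  let ?n = "sum_list ds" and ?e = "\<lambda>i. vec_split ds (unit_vec (sum_list ds) i)"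
  fix i j assume "i < dim_row (c \<cdot>\<^sub>m transpose_mat (op_mat ds ds f))"
    "j < dim_col (c \<cdot>\<^sub>m transpose_mat (op_mat ds ds f))"
  then have ij: "i < ?n" "j < ?n" by (auto simp: op_mat_def)
  have *: "op_mat ds ds f $$ (i, j) = block_prod (?e i) (f (?e j))" if ij: "i < ?n" "j < ?n" for i j
  proof -
    have "block_prod (?e i) (f (?e j)) = unit_vec ?n i \<bullet> vec_concat (f (?e j))"
      using f by (subst vec_concat_scalar_prod[symmetric]) (auto simp: vec_concat_split)
    also have "\<dots> = vec_concat (f (?e j)) $ i"
      using ij f by (intro scalar_prod_left_unit vec_concat_carrier) auto
    finally show ?thesis using ij by (simp add: op_mat_def)
  qed
  have "op_mat ds ds f $$ (i, j) = c * op_mat ds ds f $$ (j, i)"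
    unfolding *[OF ij] *[OF ij(2,1)] by (rule adj) auto
  then show "op_mat ds ds f $$ (i, j) = (c \<cdot>\<^sub>m transpose_mat (op_mat ds ds f)) $$ (i, j)"
    using ij by (simp add: op_mat_def)
qed (auto simp: op_mat_def)

lemma block_prod_commute:
  fixes xs ys :: "'a :: comm_ring_1 vec list"
  shows "dims xs = dims ys \<Longrightarrow> block_prod xs ys = block_prod ys xs"
proof (induction xs arbitrary: ys)
  case (Cons x xs)
  then obtain y ys' where ys: "ys = y # ys'" "dim_vec x = dim_vec y" "dims xs = dims ys'" by auto
  have "x \<bullet> y = y \<bullet> x"
    using ys(2) by (intro comm_scalar_prod[of _ "dim_vec y"] carrier_vecI) simp_all
  then show ?case unfolding ys(1) using Cons.IH[OF ys(3)] by (simp only: block_prod_simps)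
qed simp

text \<open>A skew map has its own negative as adjoint, which is the adjoint that
  \<open>op_mat_mult\<close> asks for.\<close>

lemma skew_symmetric_op_mat:
  assumes f: "\<And>ys. dims ys = ds \<Longrightarrow> dims (f ys) = ds"
    and skew: "\<And>xs ys. dims xs = ds \<Longrightarrow> dims ys = ds \<Longrightarrow> block_prod xs (f ys) = - block_prod ys (f xs)"
  shows "skew_symmetric_mat (sum_list ds) (op_mat ds ds f)"
    and "dims ys = ds \<Longrightarrow> op_mat ds ds f *\<^sub>v vec_concat ys = vec_concat (f ys)"
proof -
  have "op_mat ds ds f = (- 1) \<cdot>\<^sub>m transpose_mat (op_mat ds ds f)"
    by (rule op_mat_transpose[OF f]) (assumption, simp only: mult_minus1, rule skew)
  also have "\<dots> = - transpose_mat (op_mat ds ds f)" by (rule eq_matI) auto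
  finally show "skew_symmetric_mat (sum_list ds) (op_mat ds ds f)"
    unfolding skew_symmetric_mat_def by simp
  have neg: "block_prod (map uminus xs) ys = - block_prod xs ys" if "dims xs = dims ys" for xs ys :: "real vec list"
    using that by (induction xs arbitrary: ys) auto
  show "op_mat ds ds f *\<^sub>v vec_concat ys = vec_concat (f ys)" if "dims ys = ds"
  proof (rule op_mat_mult[where g = "\<lambda>xs. map uminus (f xs)"])
    fix xs ys :: "real vec list" assume *: "dims xs = ds" "dims ys = ds"
    show "block_prod xs (f ys) = block_prod (map uminus (f xs)) ys"
    proof -
      have d: "dims (f xs) = dims ys" using f[OF *(1)] *(2) by (rule trans[OF _ sym])
      show ?thesis unfolding neg[OF d] block_prod_commute[OF d] by (rule skew[OF *])
    qed
    show "dims (map uminus (f xs)) = ds" using f[OF *(1)] by (simp add: o_def)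
  qed (use f that in \<open>simp_all only:\<close>)
qed

lemma symmetric_op_mat:
  assumes f: "\<And>ys. dims ys = ds \<Longrightarrow> dims (f ys) = ds"
    and sym: "\<And>xs ys. dims xs = ds \<Longrightarrow> dims ys = ds \<Longrightarrow> block_prod xs (f ys) = block_prod ys (f xs)"
  shows "symmetric_mat (sum_list ds) (op_mat ds ds f)"
    and "dims ys = ds \<Longrightarrow> op_mat ds ds f *\<^sub>v vec_concat ys = vec_concat (f ys)"
proof -
  have "op_mat ds ds f = 1 \<cdot>\<^sub>m transpose_mat (op_mat ds ds f)"
    using f sym by (intro op_mat_transpose) auto
  also have "\<dots> = transpose_mat (op_mat ds ds f)" by (rule eq_matI) auto
  finally show "symmetric_mat (sum_list ds) (op_mat ds ds f)"
    unfolding symmetric_mat_def by simp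
  show "op_mat ds ds f *\<^sub>v vec_concat ys = vec_concat (f ys)" if "dims ys = ds"
  proof (rule op_mat_mult[where g = f])
    fix xs ys :: "real vec list" assume *: "dims xs = ds" "dims ys = ds"
    show "block_prod xs (f ys) = block_prod (f xs) ys"
      using sym[OF *] block_prod_commute[OF trans[OF f[OF *(1)] *(2)[symmetric]]] by (simp only:)
  qed (use f that in auto)
qed

lemma sym_pos_semidef_op_mat:
  assumes f: "\<And>ys. dims ys = ds \<Longrightarrow> dims (f ys) = ds"
    and sym: "\<And>xs ys. dims xs = ds \<Longrightarrow> dims ys = ds \<Longrightarrow> block_prod xs (f ys) = block_prod ys (f xs)"
    and nonneg: "\<And>xs. dims xs = ds \<Longrightarrow> 0 \<le> block_prod xs (f xs)"
  shows "sym_pos_semidef (sum_list ds) (op_mat ds ds f)"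
  unfolding sym_pos_semidef_def
proof (intro conjI ballI)
  show "symmetric_mat (sum_list ds) (op_mat ds ds f)" using f sym by (rule symmetric_op_mat(1))
  fix x :: "real vec" assume "x \<in> carrier_vec (sum_list ds)"
  then have x: "x = vec_concat (vec_split ds x)" by (simp add: vec_concat_split)
  have "op_mat ds ds f *\<^sub>v vec_concat (vec_split ds x) = vec_concat (f (vec_split ds x))"
    using f sym dims_vec_split by (rule symmetric_op_mat(2))
  then have "x \<bullet> (op_mat ds ds f *\<^sub>v x) = vec_concat (vec_split ds x) \<bullet> vec_concat (f (vec_split ds x))"
    unfolding x[symmetric] by (rule arg_cong)
  also have "\<dots> = block_prod (vec_split ds x) (f (vec_split ds x))"
    using f by (intro vec_concat_scalar_prod) simp
  finally show "0 \<le> x \<bullet> (op_mat ds ds f *\<^sub>v x)" using nonneg by simp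
qed

section \<open>Quadratic Hamiltonians\<close>

lemma symmetric_mat_form_commute:
  assumes "symmetric_mat n A" "x \<in> carrier_vec n" "y \<in> carrier_vec n"
  shows "x \<bullet> (A *\<^sub>v y) = y \<bullet> (A *\<^sub>v x)"
  using assms transpose_vec_mult_scalar[of A n n y x] comm_scalar_prod[of "A *\<^sub>v x" n y]
  unfolding symmetric_mat_def by auto

definition quad :: "real mat \<Rightarrow> real vec \<Rightarrow> real" where
  "quad A x = x \<bullet> (A *\<^sub>v x) / 2"

text \<open>Along a coordinate direction \<open>quad\<close> is a quadratic polynomial in
  \<open>h\<close>. Its two mixed terms are equal by symmetry of \<open>A\<close>, and together they
  cancel the division by 2.\<close>

lemma quad_has_derivative:
  assumes A: "symmetric_mat n A" and x: "x \<in> carrier_vec n" and i: "i < n"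
  shows "((\<lambda>h. quad A (x + h \<cdot>\<^sub>v unit_vec n i)) has_field_derivative (A *\<^sub>v x) $ i) (at 0)"
proof -
  have Ac: "A \<in> carrier_mat n n" using A unfolding symmetric_mat_def by auto
  let ?e = "unit_vec n i :: real vec"
  have e: "?e \<in> carrier_vec n" by simp
  have "quad A (x + h \<cdot>\<^sub>v ?e) = (x \<bullet> (A *\<^sub>v x) + 2 * h * (A *\<^sub>v x) $ i + h * h * (?e \<bullet> (A *\<^sub>v ?e))) / 2"
    for h
  proof -
    have "A *\<^sub>v (x + h \<cdot>\<^sub>v ?e) = A *\<^sub>v x + h \<cdot>\<^sub>v (A *\<^sub>v ?e)"
      using Ac x by (simp add: mult_add_distrib_mat_vec[of _ n n] mult_mat_vec[of _ n n])
    moreover have "x \<bullet> (A *\<^sub>v ?e) = (A *\<^sub>v x) $ i"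
      using symmetric_mat_form_commute[OF A x e] scalar_prod_left_unit[of "A *\<^sub>v x" n i] Ac i x by auto
    moreover have "?e \<bullet> (A *\<^sub>v x) = (A *\<^sub>v x) $ i"
      using Ac i x by (intro scalar_prod_left_unit) auto
    moreover have "A *\<^sub>v x \<in> carrier_vec n" "A *\<^sub>v ?e \<in> carrier_vec n" using Ac x by auto
    ultimately show ?thesis
      unfolding quad_def using x
      by (simp add: add_scalar_prod_distrib[of _ n] scalar_prod_add_distrib[of _ n]
          smult_scalar_prod_distrib[of _ n] scalar_prod_smult_distrib[of _ n] algebra_simps
          del: scalar_prod_left_unit scalar_prod_right_unit index_mult_mat_vec)
  qed
  then have eq: "(\<lambda>h. quad A (x + h \<cdot>\<^sub>v ?e)) =
      (\<lambda>h. (x \<bullet> (A *\<^sub>v x) + 2 * h * (A *\<^sub>v x) $ i + h * h * (?e \<bullet> (A *\<^sub>v ?e))) / 2)" by (rule ext)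
  show ?thesis unfolding eq by (auto intro!: derivative_eq_intros)
qed

lemma grad1_quad:
  assumes "symmetric_mat n1 A" "z1 \<in> carrier_vec n1"
  shows "grad1 n1 (\<lambda>z1 z2. quad A z1 + f z2) z1 z2 = A *\<^sub>v z1"
proof (rule eq_vecI)
  fix i assume "i < dim_vec (A *\<^sub>v z1)"
  then have i: "i < n1" using assms unfolding symmetric_mat_def by auto
  have "((\<lambda>h. quad A (z1 + h \<cdot>\<^sub>v unit_vec n1 i) + f z2) has_field_derivative (A *\<^sub>v z1) $ i) (at 0)"
    using quad_has_derivative[OF assms i] by (auto intro!: derivative_eq_intros)
  then show "grad1 n1 (\<lambda>z1 z2. quad A z1 + f z2) z1 z2 $ i = (A *\<^sub>v z1) $ i"
    using i unfolding grad1_def by (simp add: DERIV_imp_deriv del: index_mult_mat_vec)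
qed (use assms in \<open>auto simp: grad1_def symmetric_mat_def\<close>)

lemma grad2_quad:
  assumes "symmetric_mat n2 A" "z2 \<in> carrier_vec n2"
  shows "grad2 n2 (\<lambda>z1 z2. f z1 + quad A z2) z1 z2 = A *\<^sub>v z2"
proof (rule eq_vecI)
  fix i assume "i < dim_vec (A *\<^sub>v z2)"
  then have i: "i < n2" using assms unfolding symmetric_mat_def by auto
  have "((\<lambda>h. f z1 + quad A (z2 + h \<cdot>\<^sub>v unit_vec n2 i)) has_field_derivative (A *\<^sub>v z2) $ i) (at 0)"
    using quad_has_derivative[OF assms i] by (auto intro!: derivative_eq_intros)
  then show "grad2 n2 (\<lambda>z1 z2. f z1 + quad A z2) z1 z2 $ i = (A *\<^sub>v z2) $ i"
    using i unfolding grad2_def by (simp add: DERIV_imp_deriv del: index_mult_mat_vec)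
qed (use assms in \<open>auto simp: grad2_def symmetric_mat_def\<close>)

lemma continuous_vec2_fst: "i < n1 \<Longrightarrow> continuous_vec2 n1 n2 (\<lambda>z1 z2. z1 $ i)"
  and continuous_vec2_snd: "i < n2 \<Longrightarrow> continuous_vec2 n1 n2 (\<lambda>z1 z2. z2 $ i)"
proof -
  have "continuous_on UNIV (\<lambda>z :: (nat \<Rightarrow> real) \<times> (nat \<Rightarrow> real). fst z i)"
    "continuous_on UNIV (\<lambda>z :: (nat \<Rightarrow> real) \<times> (nat \<Rightarrow> real). snd z i)"
    by (rule continuous_on_product_then_coordinatewise[OF continuous_on_fst[OF continuous_on_id]],
        rule continuous_on_product_then_coordinatewise[OF continuous_on_snd[OF continuous_on_id]])
  then show "i < n1 \<Longrightarrow> continuous_vec2 n1 n2 (\<lambda>z1 z2. z1 $ i)"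
    "i < n2 \<Longrightarrow> continuous_vec2 n1 n2 (\<lambda>z1 z2. z2 $ i)"
    unfolding continuous_vec2_def case_prod_beta by simp_all
qed

lemma continuous_vec2_mult_mat_vec:
  assumes "A \<in> carrier_mat m n" "i < m" "\<And>j. j < n \<Longrightarrow> continuous_vec2 n1 n2 (\<lambda>z1 z2. f z1 z2 $ j)"
    and "\<And>z1 z2. dim_vec z1 = n1 \<Longrightarrow> dim_vec z2 = n2 \<Longrightarrow> dim_vec (f z1 z2) = n"
  shows "continuous_vec2 n1 n2 (\<lambda>z1 z2. (A *\<^sub>v f z1 z2) $ i)"
proof -
  have eq: "(A *\<^sub>v f (vec n1 x) (vec n2 y)) $ i = (\<Sum>j<n. A $$ (i, j) * f (vec n1 x) (vec n2 y) $ j)"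
    for x y using assms by (auto simp: scalar_prod_def atLeast0LessThan)
  show ?thesis
    using assms(3) unfolding continuous_vec2_def case_prod_beta eq
    by (intro continuous_intros) auto
qed

lemma C1_vec2_quad:
  assumes A: "symmetric_mat n1 A" and B: "symmetric_mat n2 B"
  shows "C1_vec2 n1 n2 (\<lambda>z1 z2. quad A z1 + quad B z2)"
proof -
  let ?H = "\<lambda>z1 z2. quad A z1 + quad B z2"
  have Ac: "A \<in> carrier_mat n1 n1" and Bc: "B \<in> carrier_mat n2 n2"
    using A B unfolding symmetric_mat_def by auto
  have "(\<lambda>h. ?H (z1 + h \<cdot>\<^sub>v unit_vec n1 i) z2) field_differentiable at 0"
    if "z1 \<in> carrier_vec n1" "i < n1" for z1 z2 i
    using quad_has_derivative[OF A that] by (auto simp: field_differentiable_def intro!: derivative_eq_intros)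
  moreover have "(\<lambda>h. ?H z1 (z2 + h \<cdot>\<^sub>v unit_vec n2 i)) field_differentiable at 0"
    if "z2 \<in> carrier_vec n2" "i < n2" for z1 z2 i
    using quad_has_derivative[OF B that] by (auto simp: field_differentiable_def intro!: derivative_eq_intros)
  moreover have "continuous_vec2 n1 n2 (\<lambda>z1 z2. grad1 n1 ?H z1 z2 $ i)" if i: "i < n1" for i
  proof -
    have "continuous_vec2 n1 n2 (\<lambda>z1 z2. (A *\<^sub>v z1) $ i)"
      using Ac i by (intro continuous_vec2_mult_mat_vec[of _ n1 n1] continuous_vec2_fst) auto
    then show ?thesis unfolding continuous_vec2_def by (simp add: grad1_quad[OF A])
  qed
  moreover have "continuous_vec2 n1 n2 (\<lambda>z1 z2. grad2 n2 ?H z1 z2 $ i)" if i: "i < n2" for i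
  proof -
    have "continuous_vec2 n1 n2 (\<lambda>z1 z2. (B *\<^sub>v z2) $ i)"
      using Bc i by (intro continuous_vec2_mult_mat_vec[of _ n2 n2] continuous_vec2_snd) auto
    then show ?thesis unfolding continuous_vec2_def by (simp add: grad2_quad[OF B])
  qed
  ultimately show ?thesis unfolding C1_vec2_def by blast
qed

section \<open>Derivatives of concatenated signals\<close>

text \<open>The entries of the concatenation agree with those of the blocks only at times in
  \<open>T\<close>, where the dimensions are known. This suffices because differentiability within
  \<open>T\<close> depends only on values on \<open>T\<close>.\<close>

lemma vec_differentiable_on_append:
  assumes "\<And>t. t \<in> T \<Longrightarrow> dim_vec (x t) = n" "\<And>t. t \<in> T \<Longrightarrow> dim_vec (y t) = m"
  shows "vec_differentiable_on (\<lambda>t. x t @\<^sub>v y t) T \<longleftrightarrow> vec_differentiable_on x T \<and> vec_differentiable_on y T"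
proof -
  have cong: "f differentiable at t within T \<longleftrightarrow> g differentiable at t within T"
    if "t \<in> T" "\<And>s. s \<in> T \<Longrightarrow> f s = g s" for f g :: "real \<Rightarrow> real" and t
    using has_derivative_transform[OF that(1), of f g] has_derivative_transform[OF that(1), of g f] that(2)
    unfolding differentiable_def by auto
  have "(\<lambda>s. (x s @\<^sub>v y s) $ i) differentiable at t within T \<longleftrightarrow> (\<lambda>s. x s $ i) differentiable at t within T"
    if "t \<in> T" "i < n" for t i using that assms by (intro cong) auto
  moreover have "(\<lambda>s. (x s @\<^sub>v y s) $ (n + i)) differentiable at t within T \<longleftrightarrow> (\<lambda>s. y s $ i) differentiable at t within T"
    if "t \<in> T" "i < m" for t i using that assms by (intro cong) auto
  moreover have "(\<forall>i<n + m. P i) \<longleftrightarrow> (\<forall>i<n. P i) \<and> (\<forall>i<m. P (n + i))" for P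
  proof (intro iffI conjI allI impI)
    fix i assume *: "(\<forall>i<n. P i) \<and> (\<forall>i<m. P (n + i))" "i < n + m"
    then show "P i" by (cases "i < n") (auto dest: spec[of _ "i - n"])
  qed auto
  ultimately show ?thesis
    using assms unfolding vec_differentiable_on_def by (auto simp: ball_conj_distrib)
qed

lemma ddt_append:
  assumes "\<And>t. t \<in> T \<Longrightarrow> dim_vec (x t) = n" "\<And>t. t \<in> T \<Longrightarrow> dim_vec (y t) = m" and t: "t \<in> T"
  shows "ddt T (\<lambda>t. x t @\<^sub>v y t) t = ddt T x t @\<^sub>v ddt T y t"
proof (rule eq_vecI)
  \<comment> \<open>\<open>vector_derivative\<close> is a choice among the derivatives that a
    function has. Functions agreeing on \<open>T\<close> have the same ones at \<open>t\<close>, so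
    the choices coincide even where none exists.\<close>
  have cong: "vector_derivative f (at t within T) = vector_derivative g (at t within T)"
    if "\<And>s. s \<in> T \<Longrightarrow> f s = g s" for f g :: "real \<Rightarrow> real"
  proof -
    have "(f has_vector_derivative d) (at t within T) \<longleftrightarrow> (g has_vector_derivative d) (at t within T)" for d
      using has_vector_derivative_transform[OF t, of f g] has_vector_derivative_transform[OF t, of g f] that
      by auto
    then show ?thesis unfolding vector_derivative_def by simp
  qed
  fix i assume "i < dim_vec (ddt T x t @\<^sub>v ddt T y t)"
  then have i: "i < n + m" using assms unfolding ddt_def by simp
  show "ddt T (\<lambda>t. x t @\<^sub>v y t) t $ i = (ddt T x t @\<^sub>v ddt T y t) $ i"
    using assms i unfolding ddt_def by (auto intro!: cong)
qed (simp add: ddt_def)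

section \<open>The structured system\<close>

lemma vec_concat_minus:
  fixes xs ys :: "'a :: group_add vec list"
  assumes "dims xs = dims ys"
  shows "vec_concat xs - vec_concat ys = vec_concat (map2 (-) xs ys)"
  using assms
proof (induction xs arbitrary: ys)
  case (Cons x xs)
  then obtain y ys' where "ys = y # ys'" "dim_vec x = dim_vec y" "dims xs = dims ys'" by auto
  then show ?case using Cons.IH[of ys'] by (simp add: append_vec_diff)
qed auto

lemma vec_concat_plus:
  fixes xs ys :: "'a :: monoid_add vec list"
  assumes "dims xs = dims ys"
  shows "vec_concat xs + vec_concat ys = vec_concat (map2 (+) xs ys)"
  using assms
proof (induction xs arbitrary: ys)
  case (Cons x xs)
  then obtain y ys' where "ys = y # ys'" "dim_vec x = dim_vec y" "dims xs = dims ys'" by auto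
  then show ?case using Cons.IH[of ys'] by (simp add: append_vec_plus)
qed auto

section \<open>Scalar product rules with dimension equations as side conditions\<close>

lemma scalar_prod_zero_right: "x \<bullet> 0\<^sub>v n = (0 :: 'a :: semiring_0)"
  unfolding scalar_prod_def by simp

lemma scalar_prod_add_right:
  fixes x y z :: "'a :: semiring_0 vec"
  shows "dim_vec y = dim_vec z \<Longrightarrow> x \<bullet> (y + z) = x \<bullet> y + x \<bullet> z"
  unfolding scalar_prod_def by (simp add: distrib_left sum.distrib)

lemma scalar_prod_minus_right:
  fixes x y z :: "'a :: ring vec"
  shows "dim_vec y = dim_vec z \<Longrightarrow> x \<bullet> (y - z) = x \<bullet> y - x \<bullet> z"
  unfolding scalar_prod_def by (simp add: right_diff_distrib sum_subtractf)

lemma scalar_prod_minus_left: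
  fixes x y z :: "'a :: ring vec"
  shows "dim_vec x = dim_vec z \<Longrightarrow> dim_vec y = dim_vec z \<Longrightarrow> (x - y) \<bullet> z = x \<bullet> z - y \<bullet> z"
  unfolding scalar_prod_def by (simp add: left_diff_distrib sum_subtractf)

lemma scalar_prod_transpose_mult:
  fixes A :: "'a :: comm_semiring_0 mat"
  assumes "dim_vec x = dim_col A" "dim_vec y = dim_row A"
  shows "x \<bullet> (transpose_mat A *\<^sub>v y) = y \<bullet> (A *\<^sub>v x)"
proof -
  have c: "x \<in> carrier_vec (dim_col A)" "y \<in> carrier_vec (dim_row A)"
    using assms by (auto intro: carrier_vecI)
  have "x \<bullet> (transpose_mat A *\<^sub>v y) = (transpose_mat A *\<^sub>v y) \<bullet> x"
    using c by (intro comm_scalar_prod[of _ "dim_col A"]) (auto intro: carrier_vecI)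
  also have "\<dots> = y \<bullet> (A *\<^sub>v x)"
    by (rule transpose_vec_mult_scalar[OF _ c]) (auto intro: carrier_matI)
  finally show ?thesis .
qed

text \<open>Two block rows of the form \<open>w\<close> and minus
  \<open>transpose_mat A *\<^sub>v w\<close> collapse into a single product; this completes the
  square in \<open>R_op_form\<close>.\<close>

lemma scalar_prod_diff_mult:
  fixes A :: "'a :: comm_ring_1 mat"
  assumes "dim_vec x = dim_row A" "dim_vec z = dim_col A" "dim_vec w = dim_row A"
  shows "(x - A *\<^sub>v z) \<bullet> w = x \<bullet> w - z \<bullet> (transpose_mat A *\<^sub>v w)"
proof -
  have "(A *\<^sub>v z) \<bullet> w = w \<bullet> (A *\<^sub>v z)"
    using assms(3) by (intro comm_scalar_prod[of _ "dim_row A"] carrier_vecI) simp_all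
  then show ?thesis
    using assms by (simp add: scalar_prod_minus_left scalar_prod_transpose_mult)
qed

lemma scalar_prod_transpose_left:
  fixes A :: "'a :: comm_semiring_0 mat"
  assumes "dim_vec x = dim_col A" "dim_vec y = dim_row A"
  shows "(transpose_mat A *\<^sub>v y) \<bullet> x = y \<bullet> (A *\<^sub>v x)"
  using assms transpose_vec_mult_scalar[OF carrier_matI carrier_vecI carrier_vecI] by blast

lemmas scalar_prod_expand = scalar_prod_zero_right scalar_prod_add_right scalar_prod_minus_right
  scalar_prod_transpose_mult

lemma symmetric_mat_commute_dim:
  "symmetric_mat n A \<Longrightarrow> dim_vec x = n \<Longrightarrow> dim_vec y = n \<Longrightarrow> x \<bullet> (A *\<^sub>v y) = y \<bullet> (A *\<^sub>v x)"
  by (erule symmetric_mat_form_commute; erule carrier_vecI)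

lemma sym_pos_semidef_nonneg_dim:
  "sym_pos_semidef n A \<Longrightarrow> dim_vec x = n \<Longrightarrow> 0 \<le> x \<bullet> (A *\<^sub>v x)"
  unfolding sym_pos_semidef_def using carrier_vecI[of x n] by blast

section \<open>The coupled system as abstract linear algebra\<close>

text \<open>Only the algebraic properties of the field and circuit matrices are kept.
  \<open>Xs\<close>, \<open>Xo\<close> stand for \<open>X_str\<close>, \<open>X_sol\<close>; the
  foil matrix occurs as \<open>M3 * Y\<close>; \<open>EC\<close> and \<open>P\<close> are the nodal
  capacitance and conductance matrices; \<open>As\<close>, \<open>Af\<close>, \<open>Ai\<close> are
  the column blocks of \<open>A_I\<close>; \<open>S\<close> selects the solid currents from
  \<open>j_V\<close>, and \<open>T\<close> embeds the source voltages.\<close>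

locale coupled_blocks =
  fixes w1 w2 w3 np nl ns nso nfo nv ni nvs :: nat
    and K1 K2 K3 M1 M2 M3 Xs Rs Xo Y c EC L P AL AV As Af Ai S T :: "real mat"
  assumes K1: "symmetric_mat w1 K1" and K2: "symmetric_mat w2 K2" and K3: "symmetric_mat w3 K3"
    and M1: "sym_pos_semidef w1 M1" and M2: "sym_pos_semidef w2 M2" and M3: "sym_pos_semidef w3 M3"
    and Rs: "sym_pos_semidef ns Rs" and P: "sym_pos_semidef np P"
    and EC: "symmetric_mat np EC" and L: "symmetric_mat nl L"
    and Xs: "Xs \<in> carrier_mat w1 ns" and Xo: "Xo \<in> carrier_mat w2 nso"
    and Y: "Y \<in> carrier_mat w3 nfo" and c: "c \<in> carrier_mat nfo 1"
    and AL: "AL \<in> carrier_mat np nl" and AV: "AV \<in> carrier_mat np nv"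
    and As: "As \<in> carrier_mat np ns" and Af: "Af \<in> carrier_mat np 1"
    and Ai: "Ai \<in> carrier_mat np ni"
    and S: "S \<in> carrier_mat nso nv" and T: "T \<in> carrier_mat nv nvs"
begin

lemmas square = sym_pos_semidef_def[THEN iffD1, OF M1, THEN conjunct1]
  sym_pos_semidef_def[THEN iffD1, OF M2, THEN conjunct1]
  sym_pos_semidef_def[THEN iffD1, OF M3, THEN conjunct1]
  sym_pos_semidef_def[THEN iffD1, OF Rs, THEN conjunct1]
  sym_pos_semidef_def[THEN iffD1, OF P, THEN conjunct1] K1 K2 K3 EC L

lemma mat_dims [simp]:
  "dim_row K1 = w1" "dim_col K1 = w1" "dim_row K2 = w2" "dim_col K2 = w2"
  "dim_row K3 = w3" "dim_col K3 = w3" "dim_row M1 = w1" "dim_col M1 = w1"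
  "dim_row M2 = w2" "dim_col M2 = w2" "dim_row M3 = w3" "dim_col M3 = w3"
  "dim_row Rs = ns" "dim_col Rs = ns" "dim_row P = np" "dim_col P = np"
  "dim_row EC = np" "dim_col EC = np" "dim_row L = nl" "dim_col L = nl"
  "dim_row Xs = w1" "dim_col Xs = ns" "dim_row Xo = w2" "dim_col Xo = nso"
  "dim_row Y = w3" "dim_col Y = nfo" "dim_row c = nfo" "dim_col c = 1"
  "dim_row AL = np" "dim_col AL = nl" "dim_row AV = np" "dim_col AV = nv"
  "dim_row As = np" "dim_col As = ns" "dim_row Af = np" "dim_col Af = 1"
  "dim_row Ai = np" "dim_col Ai = ni" "dim_row S = nso" "dim_col S = nv"
  "dim_row T = nv" "dim_col T = nvs"
  using square Xs Xo Y c AL AV As Af Ai S T unfolding symmetric_mat_def by auto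

lemmas forms_commute = square[THEN symmetric_mat_commute_dim]

lemmas forms_nonneg = M1[THEN sym_pos_semidef_nonneg_dim] M2[THEN sym_pos_semidef_nonneg_dim]
  M3[THEN sym_pos_semidef_nonneg_dim] Rs[THEN sym_pos_semidef_nonneg_dim] P[THEN sym_pos_semidef_nonneg_dim]

text \<open>Block order: \<open>a\<^sub>1, a\<^sub>2, a\<^sub>3, \<phi>, j\<^sub>L, i\<^sub>s\<^sub>t\<^sub>r, v\<^sub>s\<^sub>o\<^sub>l, e, i\<^sub>f\<^sub>o\<^sub>i\<^sub>l, j\<^sub>V\<close>, where for the first three blocks the
  time derivatives stand on the right-hand side.\<close>

definition "bdims = [w1, w2, w3, np, nl, ns, nso, nfo, 1, nv]"

lemma bdims_cases:
  assumes "dims x = bdims"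
  obtains x0 x1 x2 x3 x4 x5 x6 x7 x8 x9 where "x = [x0, x1, x2, x3, x4, x5, x6, x7, x8, x9]"
    "dim_vec x0 = w1" "dim_vec x1 = w2" "dim_vec x2 = w3" "dim_vec x3 = np" "dim_vec x4 = nl"
    "dim_vec x5 = ns" "dim_vec x6 = nso" "dim_vec x7 = nfo" "dim_vec x8 = 1" "dim_vec x9 = nv"
  using assms unfolding bdims_def map_eq_Cons_conv list.map_disc_iff by blast

lemma dims2_cases:
  assumes "dims x = [a, b]"
  obtains x0 x1 where "x = [x0, x1]" "dim_vec x0 = a" "dim_vec x1 = b"
  using assms unfolding map_eq_Cons_conv list.map_disc_iff by blast

lemma dims3_cases:
  assumes "dims x = [a, b, d]"
  obtains x0 x1 x2 where "x = [x0, x1, x2]" "dim_vec x0 = a" "dim_vec x1 = b" "dim_vec x2 = d"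
  using assms unfolding map_eq_Cons_conv list.map_disc_iff by blast

text \<open>Each equation is taken with the sign that makes its couplings skew, for instance
  \<open>S\<close> in row 6 against minus its transpose in row 9. Rows 1 and 2 vanish since the
  solid and foil fields meet their terminals only through dissipative terms.\<close>

definition "J_op y = [Xs *\<^sub>v y ! 5, 0\<^sub>v w2, 0\<^sub>v w3,
  - (AL *\<^sub>v y ! 4 + As *\<^sub>v y ! 5 + Af *\<^sub>v y ! 8 + AV *\<^sub>v y ! 9), transpose_mat AL *\<^sub>v y ! 3,
  transpose_mat As *\<^sub>v y ! 3 - transpose_mat Xs *\<^sub>v y ! 0, S *\<^sub>v y ! 9, c *\<^sub>v y ! 8,
  transpose_mat Af *\<^sub>v y ! 3 - transpose_mat c *\<^sub>v y ! 7,
  transpose_mat AV *\<^sub>v y ! 3 - transpose_mat S *\<^sub>v y ! 6]"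

text \<open>Rows 1 and 6 and rows 2 and 7 are the two conductor congruences written out row by row.
  The zero rows are lossless: inductor equations, foil voltage balance and voltage branches.\<close>

definition "R_op y = [M1 *\<^sub>v y ! 0, M2 *\<^sub>v (y ! 1 - Xo *\<^sub>v y ! 6), M3 *\<^sub>v (y ! 2 - Y *\<^sub>v y ! 7),
  P *\<^sub>v y ! 3, 0\<^sub>v nl, Rs *\<^sub>v y ! 5,
  - (transpose_mat Xo *\<^sub>v (M2 *\<^sub>v (y ! 1 - Xo *\<^sub>v y ! 6))),
  - (transpose_mat Y *\<^sub>v (M3 *\<^sub>v (y ! 2 - Y *\<^sub>v y ! 7))), 0\<^sub>v 1, 0\<^sub>v nv]"

definition "B_op u = [0\<^sub>v w1, 0\<^sub>v w2, 0\<^sub>v w3, - (Ai *\<^sub>v u ! 0), 0\<^sub>v nl, 0\<^sub>v ns, 0\<^sub>v nso, 0\<^sub>v nfo,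
  0\<^sub>v 1, - (T *\<^sub>v u ! 1)]"

definition "K_op a = [K1 *\<^sub>v a ! 0, K2 *\<^sub>v a ! 1, K3 *\<^sub>v a ! 2]"

definition "E_op z = [EC *\<^sub>v z ! 0, L *\<^sub>v z ! 1]"

definition "Jm = op_mat bdims bdims J_op"
definition "Rm = op_mat bdims bdims R_op"
definition "Bm = op_mat bdims [ni, nvs] B_op"
definition "Km = op_mat [w1, w2, w3] [w1, w2, w3] K_op"
definition "Em = op_mat [np, nl] [np, nl] E_op"

lemma dims_ops:
  "dims y = bdims \<Longrightarrow> dims (J_op y) = bdims" "dims y = bdims \<Longrightarrow> dims (R_op y) = bdims"
  "dims u = [ni, nvs] \<Longrightarrow> dims (B_op u) = bdims"
  "dims a = [w1, w2, w3] \<Longrightarrow> dims (K_op a) = [w1, w2, w3]"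
  "dims z = [np, nl] \<Longrightarrow> dims (E_op z) = [np, nl]"
  unfolding J_op_def R_op_def B_op_def K_op_def E_op_def
  by (simp_all add: bdims_def)

lemma J_op_skew:
  assumes "dims x = bdims" "dims y = bdims"
  shows "block_prod x (J_op y) = - block_prod y (J_op x)"
  by (rule bdims_cases[OF assms(1)], rule bdims_cases[OF assms(2)])
    (simp add: J_op_def scalar_prod_expand)

text \<open>With the squares completed, the form is a sum of five semidefinite forms, so symmetry
  and nonnegativity can be read off term by term.\<close>

lemma R_op_form:
  assumes "dims x = bdims" "dims y = bdims"
  shows "block_prod x (R_op y) = x ! 0 \<bullet> (M1 *\<^sub>v y ! 0)
    + (x ! 1 - Xo *\<^sub>v x ! 6) \<bullet> (M2 *\<^sub>v (y ! 1 - Xo *\<^sub>v y ! 6))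
    + (x ! 2 - Y *\<^sub>v x ! 7) \<bullet> (M3 *\<^sub>v (y ! 2 - Y *\<^sub>v y ! 7))
    + x ! 3 \<bullet> (P *\<^sub>v y ! 3) + x ! 5 \<bullet> (Rs *\<^sub>v y ! 5)"
  by (rule bdims_cases[OF assms(1)], rule bdims_cases[OF assms(2)])
    (simp add: R_op_def scalar_prod_zero_right scalar_prod_diff_mult)

lemma bdims_nth:
  assumes "dims x = bdims"
  shows "dim_vec (x ! 0) = w1" "dim_vec (x ! 1) = w2" "dim_vec (x ! 2) = w3" "dim_vec (x ! 3) = np"
    "dim_vec (x ! 5) = ns"
  by (rule bdims_cases[OF assms], simp)+

lemma R_op_symmetric:
  assumes "dims x = bdims" "dims y = bdims"
  shows "block_prod x (R_op y) = block_prod y (R_op x)"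
  unfolding R_op_form[OF assms] R_op_form[OF assms(2,1)]
  using bdims_nth[OF assms(1)] bdims_nth[OF assms(2)]
  by (intro arg_cong2[of _ _ _ _ "(+)"] forms_commute) auto

lemma R_op_nonneg:
  assumes "dims x = bdims"
  shows "0 \<le> block_prod x (R_op x)"
  unfolding R_op_form[OF assms assms] using bdims_nth[OF assms]
  by (intro add_nonneg_nonneg forms_nonneg) auto

lemma J_mat: "skew_symmetric_mat (sum_list bdims) Jm"
  "dims y = bdims \<Longrightarrow> Jm *\<^sub>v vec_concat y = vec_concat (J_op y)"
  unfolding Jm_def
  by (rule skew_symmetric_op_mat; use dims_ops J_op_skew in blast)+

lemma R_mat: "sym_pos_semidef (sum_list bdims) Rm"
  "dims y = bdims \<Longrightarrow> Rm *\<^sub>v vec_concat y = vec_concat (R_op y)"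
  unfolding Rm_def
   apply (rule sym_pos_semidef_op_mat; use dims_ops R_op_symmetric R_op_nonneg in blast)
  by (rule symmetric_op_mat(2); use dims_ops R_op_symmetric in blast)

lemma K_mat_block: "symmetric_mat (w1 + w2 + w3) Km"
  "dims a = [w1, w2, w3] \<Longrightarrow> Km *\<^sub>v vec_concat a = vec_concat (K_op a)"
proof -
  have sym: "block_prod a (K_op b) = block_prod b (K_op a)"
    if "dims a = [w1, w2, w3]" "dims b = [w1, w2, w3]" for a b
    by (rule dims3_cases[OF that(1)], rule dims3_cases[OF that(2)]) (simp add: K_op_def forms_commute)
  show "dims a = [w1, w2, w3] \<Longrightarrow> Km *\<^sub>v vec_concat a = vec_concat (K_op a)"
    unfolding Km_def by (rule symmetric_op_mat(2)[OF dims_ops(4) sym])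
  have "symmetric_mat (sum_list [w1, w2, w3]) Km"
    unfolding Km_def by (rule symmetric_op_mat(1)[OF dims_ops(4) sym])
  then show "symmetric_mat (w1 + w2 + w3) Km" by (simp add: add.assoc)
qed

lemma E_mat_block: "symmetric_mat (np + nl) Em"
  "dims z = [np, nl] \<Longrightarrow> Em *\<^sub>v vec_concat z = vec_concat (E_op z)"
proof -
  have sym: "block_prod a (E_op b) = block_prod b (E_op a)"
    if "dims a = [np, nl]" "dims b = [np, nl]" for a b
    by (rule dims2_cases[OF that(1)], rule dims2_cases[OF that(2)]) (simp add: E_op_def forms_commute)
  show "dims z = [np, nl] \<Longrightarrow> Em *\<^sub>v vec_concat z = vec_concat (E_op z)"
    unfolding Em_def by (rule symmetric_op_mat(2)[OF dims_ops(5) sym])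
  have "symmetric_mat (sum_list [np, nl]) Em"
    unfolding Em_def by (rule symmetric_op_mat(1)[OF dims_ops(5) sym])
  then show "symmetric_mat (np + nl) Em" by simp
qed

lemma B_mat_block:
  assumes "dims u = [ni, nvs]"
  shows "Bm *\<^sub>v vec_concat u = vec_concat (B_op u)"
  unfolding Bm_def
proof (rule op_mat_mult[where g = "\<lambda>x. [- (transpose_mat Ai *\<^sub>v x ! 3), - (transpose_mat T *\<^sub>v x ! 9)]"])
  fix x y :: "real vec list" assume *: "dims x = bdims" "dims y = [ni, nvs]"
  show "block_prod x (B_op y) = block_prod [- (transpose_mat Ai *\<^sub>v x ! 3), - (transpose_mat T *\<^sub>v x ! 9)] y"
    by (rule bdims_cases[OF *(1)], rule dims2_cases[OF *(2)])
      (simp add: B_op_def scalar_prod_zero_right scalar_prod_transpose_left)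
qed (use assms dims_ops in simp_all)

text \<open>Both sides have the same block dimensions, so one equation between long vectors splits
  into ten equations between blocks.\<close>

lemma vec_system_iff:
  assumes "dims l = bdims" "dims y = bdims" "dims u = [ni, nvs]"
  shows "vec_concat l = (Jm - Rm) *\<^sub>v vec_concat y + Bm *\<^sub>v vec_concat u \<longleftrightarrow>
    l = map2 (+) (map2 (-) (J_op y) (R_op y)) (B_op u)"
proof -
  let ?n = "sum_list bdims"
  have "Jm \<in> carrier_mat ?n ?n" "Rm \<in> carrier_mat ?n ?n" unfolding Jm_def Rm_def by auto
  then have "(Jm - Rm) *\<^sub>v vec_concat y = Jm *\<^sub>v vec_concat y - Rm *\<^sub>v vec_concat y"
    using vec_concat_carrier[OF assms(2)] by (rule minus_mult_distrib_mat_vec)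
  also have "\<dots> = vec_concat (map2 (-) (J_op y) (R_op y))"
    unfolding J_mat(2)[OF assms(2)] R_mat(2)[OF assms(2)]
    using dims_ops(1,2)[OF assms(2)] by (intro vec_concat_minus) simp
  finally have *: "(Jm - Rm) *\<^sub>v vec_concat y = vec_concat (map2 (-) (J_op y) (R_op y))" .
  have d: "dims (map2 (-) (J_op y) (R_op y)) = bdims"
    using dims_ops(2)[OF assms(2)] by (simp add: J_op_def R_op_def bdims_def)
  have "(Jm - Rm) *\<^sub>v vec_concat y + Bm *\<^sub>v vec_concat u =
      vec_concat (map2 (+) (map2 (-) (J_op y) (R_op y)) (B_op u))"
    unfolding * B_mat_block[OF assms(3)] using d dims_ops(3)[OF assms(3)]
    by (intro vec_concat_plus) simp
  moreover have "dims (map2 (+) (map2 (-) (J_op y) (R_op y)) (B_op u)) = bdims"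
    using dims_ops(3)[OF assms(3)] by (simp add: J_op_def R_op_def B_op_def bdims_def)
  ultimately show ?thesis using assms(1) by (simp add: vec_concat_eq_iff)
qed

end

section \<open>From block rows back to the model equations\<close>

text \<open>A row \<open>x = y\<close> of the structured system is compared with a model equation
  \<open>z = 0\<close> whose left-hand side is the residual of the row up to a factor
  \<open>s\<close>.\<close>

lemma vec_eq_iff_zero:
  fixes x y z :: "real vec"
  assumes "dim_vec x = n" "dim_vec y = n" "dim_vec z = n"
    and "\<And>k. k < n \<Longrightarrow> z $ k = s * (x $ k - y $ k)" and "s \<noteq> 0"
  shows "x = y \<longleftrightarrow> z = 0\<^sub>v n"
proof -
  have "x = y \<longleftrightarrow> (\<forall>k<n. x $ k = y $ k)" using assms(1,2) by (auto intro: eq_vecI)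
  also have "\<dots> \<longleftrightarrow> (\<forall>k<n. z $ k = 0)" using assms(4,5) by auto
  also have "\<dots> \<longleftrightarrow> z = 0\<^sub>v n"
  proof
    assume "\<forall>k<n. z $ k = 0"
    then show "z = 0\<^sub>v n" using assms(3) by (intro eq_vecI) simp_all
  qed simp
  finally show ?thesis .
qed

lemma mult_minus_dim:
  fixes A B :: "real mat"
  assumes "dim_col A = dim_vec a" "dim_row B = dim_vec a" "dim_col B = dim_vec v"
  shows "A *\<^sub>v (a - B *\<^sub>v v) = A *\<^sub>v a - (A * B) *\<^sub>v v"
proof -
  have c: "A \<in> carrier_mat (dim_row A) (dim_vec a)" "B \<in> carrier_mat (dim_vec a) (dim_vec v)"
    "a \<in> carrier_vec (dim_vec a)" "v \<in> carrier_vec (dim_vec v)"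
    using assms by (auto intro: carrier_matI carrier_vecI)
  show ?thesis
    unfolding mult_minus_distrib_mat_vec[OF c(1,3) mult_mat_vec_carrier[OF c(2,4)]]
      assoc_mult_mat_vec[OF c(1,2,4)] ..
qed

lemma mult_mat_vec_assoc_dim:
  fixes A B :: "real mat"
  assumes "dim_col A = dim_row B" "dim_col B = dim_vec v"
  shows "A *\<^sub>v (B *\<^sub>v v) = (A * B) *\<^sub>v v"
  by (rule assoc_mult_mat_vec[symmetric, of _ "dim_row A" "dim_row B" _ "dim_col B"])
    (use assms in \<open>auto intro: carrier_matI carrier_vecI\<close>)

lemma mult_mat_vec_minus_dim:
  fixes A :: "real mat"
  assumes "dim_vec x = dim_col A" "dim_vec y = dim_col A"
  shows "A *\<^sub>v (x - y) = A *\<^sub>v x - A *\<^sub>v y"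
  by (rule mult_minus_distrib_mat_vec[of _ "dim_row A" "dim_col A"])
    (use assms in \<open>auto intro: carrier_matI carrier_vecI\<close>)

context coupled_blocks
begin

text \<open>This concerns a single instant: primed letters take the place of time derivatives and
  \<open>b1\<close>, \<open>b2\<close>, \<open>b3\<close> that of the potentials, with no relation
  assumed between them. The conjuncts follow the order and bracketing of the model equations, not
  the row order.\<close>

lemma system_iff:
  assumes d: "dims [a1', a2', a3', p, l, i, v, e, f, j] = bdims"
    and d': "dims [b1, b2, b3] = [w1, w2, w3]" "dims [p', l'] = [np, nl]"
    and u: "dims [si, sv] = [ni, nvs]"
  shows "vec_concat (K_op [b1, b2, b3] @ E_op [p', l'] @ [0\<^sub>v ns, 0\<^sub>v nso, 0\<^sub>v nfo, 0\<^sub>v 1, 0\<^sub>v nv]) =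
      (Jm - Rm) *\<^sub>v vec_concat [a1', a2', a3', p, l, i, v, e, f, j] + Bm *\<^sub>v vec_concat [si, sv] \<longleftrightarrow>
    M1 *\<^sub>v a1' + K1 *\<^sub>v b1 - Xs *\<^sub>v i = 0\<^sub>v w1 \<and>
    transpose_mat Xs *\<^sub>v a1' + Rs *\<^sub>v i - transpose_mat As *\<^sub>v p = 0\<^sub>v ns \<and>
    M2 *\<^sub>v a2' + K2 *\<^sub>v b2 - (M2 * Xo) *\<^sub>v v = 0\<^sub>v w2 \<and>
    - ((transpose_mat Xo * M2) *\<^sub>v a2') + (transpose_mat Xo * (M2 * Xo)) *\<^sub>v v - S *\<^sub>v j = 0\<^sub>v nso \<and>
    M3 *\<^sub>v a3' + K3 *\<^sub>v b3 - (M3 * Y) *\<^sub>v e = 0\<^sub>v w3 \<and>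
    - ((transpose_mat Y * M3) *\<^sub>v a3') + (transpose_mat Y * (M3 * Y)) *\<^sub>v e - c *\<^sub>v f = 0\<^sub>v nfo \<and>
    - (transpose_mat c *\<^sub>v e) + transpose_mat Af *\<^sub>v p = 0\<^sub>v 1 \<and>
    EC *\<^sub>v p' + P *\<^sub>v p + AL *\<^sub>v l + AV *\<^sub>v j + (As *\<^sub>v i + (Af *\<^sub>v f + Ai *\<^sub>v si)) = 0\<^sub>v np \<and>
    L *\<^sub>v l' - transpose_mat AL *\<^sub>v p = 0\<^sub>v nl \<and>
    transpose_mat AV *\<^sub>v p - (transpose_mat S *\<^sub>v v + T *\<^sub>v sv) = 0\<^sub>v nv"
    (is "?sys \<longleftrightarrow> ?r0 \<and> ?r5 \<and> ?r1 \<and> ?r6 \<and> ?r2 \<and> ?r7 \<and> ?r8 \<and> ?r3 \<and> ?r4 \<and> ?r9")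
proof -
  have dim: "dim_vec a1' = w1" "dim_vec a2' = w2" "dim_vec a3' = w3" "dim_vec p = np"
    "dim_vec l = nl" "dim_vec i = ns" "dim_vec v = nso" "dim_vec e = nfo" "dim_vec f = 1"
    "dim_vec j = nv" "dim_vec b1 = w1" "dim_vec b2 = w2" "dim_vec b3 = w3" "dim_vec p' = np"
    "dim_vec l' = nl" "dim_vec si = ni" "dim_vec sv = nvs"
    using d d' u unfolding bdims_def by simp_all
  note index_mult_mat_vec[simp del]
  \<comment> \<open>The squares are multiplied out again, bracketed so that the products can later
    be identified with \<open>G_sol\<close>, \<open>X_foil\<close> and
    \<open>G_foil\<close>.\<close>
  have M2: "M2 *\<^sub>v (a2' - Xo *\<^sub>v v) = M2 *\<^sub>v a2' - (M2 * Xo) *\<^sub>v v"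
    and M3: "M3 *\<^sub>v (a3' - Y *\<^sub>v e) = M3 *\<^sub>v a3' - (M3 * Y) *\<^sub>v e"
    by (rule mult_minus_dim; simp add: dim)+
  have XM2: "transpose_mat Xo *\<^sub>v (M2 *\<^sub>v a2' - (M2 * Xo) *\<^sub>v v) =
      (transpose_mat Xo * M2) *\<^sub>v a2' - (transpose_mat Xo * (M2 * Xo)) *\<^sub>v v"
    and YM3: "transpose_mat Y *\<^sub>v (M3 *\<^sub>v a3' - (M3 * Y) *\<^sub>v e) =
      (transpose_mat Y * M3) *\<^sub>v a3' - (transpose_mat Y * (M3 * Y)) *\<^sub>v e"
    by (simp_all add: dim mult_mat_vec_minus_dim mult_mat_vec_assoc_dim del: assoc_mult_mat)
  have "?sys \<longleftrightarrow> K_op [b1, b2, b3] @ E_op [p', l'] @ [0\<^sub>v ns, 0\<^sub>v nso, 0\<^sub>v nfo, 0\<^sub>v 1, 0\<^sub>v nv] =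
      map2 (+) (map2 (-) (J_op [a1', a2', a3', p, l, i, v, e, f, j]) (R_op [a1', a2', a3', p, l, i, v, e, f, j]))
        (B_op [si, sv])"
    by (rule vec_system_iff[OF _ d u]) (simp add: K_op_def E_op_def bdims_def)
  also have "\<dots> \<longleftrightarrow>
    K1 *\<^sub>v b1 = Xs *\<^sub>v i - M1 *\<^sub>v a1' + 0\<^sub>v w1 \<and>
    K2 *\<^sub>v b2 = 0\<^sub>v w2 - (M2 *\<^sub>v a2' - (M2 * Xo) *\<^sub>v v) + 0\<^sub>v w2 \<and>
    K3 *\<^sub>v b3 = 0\<^sub>v w3 - (M3 *\<^sub>v a3' - (M3 * Y) *\<^sub>v e) + 0\<^sub>v w3 \<and>
    EC *\<^sub>v p' = - (AL *\<^sub>v l + As *\<^sub>v i + Af *\<^sub>v f + AV *\<^sub>v j) - P *\<^sub>v p + - (Ai *\<^sub>v si) \<and>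
    L *\<^sub>v l' = transpose_mat AL *\<^sub>v p - 0\<^sub>v nl + 0\<^sub>v nl \<and>
    0\<^sub>v ns = transpose_mat As *\<^sub>v p - transpose_mat Xs *\<^sub>v a1' - Rs *\<^sub>v i + 0\<^sub>v ns \<and>
    0\<^sub>v nso = S *\<^sub>v j - - ((transpose_mat Xo * M2) *\<^sub>v a2' - (transpose_mat Xo * (M2 * Xo)) *\<^sub>v v) + 0\<^sub>v nso \<and>
    0\<^sub>v nfo = c *\<^sub>v f - - ((transpose_mat Y * M3) *\<^sub>v a3' - (transpose_mat Y * (M3 * Y)) *\<^sub>v e) + 0\<^sub>v nfo \<and>
    0\<^sub>v 1 = transpose_mat Af *\<^sub>v p - transpose_mat c *\<^sub>v e - 0\<^sub>v 1 + 0\<^sub>v 1 \<and>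
    0\<^sub>v nv = transpose_mat AV *\<^sub>v p - transpose_mat S *\<^sub>v v - 0\<^sub>v nv + - (T *\<^sub>v sv)"
    (is "_ \<longleftrightarrow> ?s0 \<and> ?s1 \<and> ?s2 \<and> ?s3 \<and> ?s4 \<and> ?s5 \<and> ?s6 \<and> ?s7 \<and> ?s8 \<and> ?s9")
    unfolding J_op_def R_op_def B_op_def K_op_def E_op_def XM2[symmetric] YM3[symmetric] M2[symmetric] M3[symmetric]
    by (simp del: minus_zero_vec zero_minus_vec right_zero_vec left_zero_vec)
  finally have sys: "?sys \<longleftrightarrow> ?s0 \<and> ?s1 \<and> ?s2 \<and> ?s3 \<and> ?s4 \<and> ?s5 \<and> ?s6 \<and> ?s7 \<and> ?s8 \<and> ?s9" .
  have "?s0 \<longleftrightarrow> ?r0" by (rule vec_eq_iff_zero[where s = 1]) (simp_all add: dim)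
  moreover have "?s1 \<longleftrightarrow> ?r1" by (rule vec_eq_iff_zero[where s = 1]) (simp_all add: dim)
  moreover have "?s2 \<longleftrightarrow> ?r2" by (rule vec_eq_iff_zero[where s = 1]) (simp_all add: dim)
  moreover have "?s3 \<longleftrightarrow> ?r3" by (rule vec_eq_iff_zero[where s = 1]) (simp_all add: dim)
  moreover have "?s4 \<longleftrightarrow> ?r4" by (rule vec_eq_iff_zero[where s = 1]) (simp_all add: dim)
  moreover have "?s5 \<longleftrightarrow> ?r5" by (rule vec_eq_iff_zero[where s = 1]) (simp_all add: dim)
  moreover have "?s6 \<longleftrightarrow> ?r6" by (rule vec_eq_iff_zero[where s = 1]) (simp_all add: dim)
  moreover have "?s7 \<longleftrightarrow> ?r7" by (rule vec_eq_iff_zero[where s = 1]) (simp_all add: dim)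
  \<comment> \<open>In rows 8 and 9 the model equation is already the right-hand side of the row,
    whose left-hand side is zero; hence the factor \<open>- 1\<close>.\<close>
  moreover have "?s8 \<longleftrightarrow> ?r8" by (rule vec_eq_iff_zero[where s = "- 1"]) (simp_all add: dim)
  moreover have "?s9 \<longleftrightarrow> ?r9" by (rule vec_eq_iff_zero[where s = "- 1"]) (simp_all add: dim)
  ultimately show ?thesis unfolding sys by argo
qed

lemma sum_list_bdims:
  "sum_list bdims = (w1 + w2 + w3) + (np + nl) + (ns + nso + nfo + 1 + nv)"
  unfolding bdims_def by simp

definition "Ham z1 z2 = quad Km z1 + quad Em z2"

text \<open>As \<open>e\<close> returns \<open>z2\<close> itself, the condition on the gradient
  reduces to the symmetry of \<open>Em\<close>; a singular nodal capacitance matrix causes no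
  difficulty.\<close>

lemma admissible:
  "admissible_structure (w1 + w2 + w3) (np + nl) (ns + nso + nfo + 1 + nv) (ni + nvs)
     Ham (\<lambda>z1 z2. z2) Em Jm Rm Bm"
  unfolding admissible_structure_def
proof (intro conjI allI impI ballI)
  have Ec: "Em \<in> carrier_mat (np + nl) (np + nl)" and Et: "transpose_mat Em = Em"
    using E_mat_block(1) unfolding symmetric_mat_def by auto
  show "C1_vec2 (w1 + w2 + w3) (np + nl) Ham"
    unfolding Ham_def[abs_def] by (rule C1_vec2_quad[OF K_mat_block(1) E_mat_block(1)])
  show "Em \<in> carrier_mat (np + nl) (np + nl)" by (rule Ec)
  show "skew_symmetric_mat (w1 + w2 + w3 + (np + nl) + (ns + nso + nfo + 1 + nv)) Jm"
    using J_mat(1) unfolding sum_list_bdims .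
  show "sym_pos_semidef (w1 + w2 + w3 + (np + nl) + (ns + nso + nfo + 1 + nv)) Rm"
    using R_mat(1) unfolding sum_list_bdims .
  show "Bm \<in> carrier_mat (w1 + w2 + w3 + (np + nl) + (ns + nso + nfo + 1 + nv)) (ni + nvs)"
    using op_mat_carrier[of bdims "[ni, nvs]" B_op] unfolding Bm_def sum_list_bdims by simp
  fix z1 z2 :: "real vec" assume "z2 \<in> carrier_vec (np + nl)"
  then show "transpose_mat Em *\<^sub>v z2 = grad2 (np + nl) Ham z1 z2"
    unfolding Ham_def[abs_def] Et by (subst grad2_quad[OF E_mat_block(1)]) auto
qed (simp_all add: continuous_vec2_snd)

end

section \<open>Circuit matrices, selectors and scalar blocks\<close>

lemma sym_pos_def_imp_semidef:
  assumes "sym_pos_def n A"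
  shows "sym_pos_semidef n A"
proof -
  have A: "A \<in> carrier_mat n n" using assms unfolding sym_pos_def_def symmetric_mat_def by auto
  have "0 \<le> x \<bullet> (A *\<^sub>v x)" if x: "x \<in> carrier_vec n" for x
  proof (cases "x = 0\<^sub>v n")
    case True
    have "A *\<^sub>v x \<in> carrier_vec n" using A x by (rule mult_mat_vec_carrier)
    then show ?thesis unfolding True by (simp add: scalar_prod_left_zero del: index_mult_mat_vec)
  next
    case False
    then show ?thesis using assms x unfolding sym_pos_def_def by (auto intro: less_imp_le)
  qed
  then show ?thesis using assms unfolding sym_pos_def_def sym_pos_semidef_def by blast
qed

lemma sym_pos_semidef_outer_congruence:
  assumes "sym_pos_def m M" "A \<in> carrier_mat n m"
  shows "sym_pos_semidef n (A * M * transpose_mat A)"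
  using sym_pos_semidef_congruence[OF sym_pos_def_imp_semidef[OF assms(1)], of "transpose_mat A" n] assms(2)
  by simp

lemma col_block_all: "A \<in> carrier_mat m n \<Longrightarrow> col_block A 0 n = A"
  unfolding col_block_def by (rule eq_matI) auto

lemma col_block_mult_append:
  fixes A :: "real mat"
  assumes "x \<in> carrier_vec n1" "y \<in> carrier_vec n2"
  shows "col_block A k (n1 + n2) *\<^sub>v (x @\<^sub>v y) = col_block A k n1 *\<^sub>v x + col_block A (k + n1) n2 *\<^sub>v y"
proof (rule eq_vecI)
  fix i assume "i < dim_vec (col_block A k n1 *\<^sub>v x + col_block A (k + n1) n2 *\<^sub>v y)"
  then have i: "i < dim_row A" by (simp add: col_block_def)
  have r: "row (col_block A k (n1 + n2)) i = row (col_block A k n1) i @\<^sub>v row (col_block A (k + n1) n2) i"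
    by (rule eq_vecI) (use i in \<open>auto simp: col_block_def\<close>)
  have "row (col_block A k n1) i \<in> carrier_vec n1" "row (col_block A (k + n1) n2) i \<in> carrier_vec n2"
    by (rule carrier_vecI, simp add: col_block_def)+
  then show "(col_block A k (n1 + n2) *\<^sub>v (x @\<^sub>v y)) $ i =
      (col_block A k n1 *\<^sub>v x + col_block A (k + n1) n2 *\<^sub>v y) $ i"
    using i scalar_prod_append[OF _ _ assms] r by (simp add: col_block_def)
qed (simp add: col_block_def)

text \<open>This is the block row [I 0]. It selects the solid currents from \<open>j_V\<close>,
  while its transpose inserts \<open>v_sol\<close> into the vector of source voltages. That one
  matrix serves both purposes makes the coupling of solid conductors to the circuit skew.\<close>

definition first_mat :: "nat \<Rightarrow> nat \<Rightarrow> real mat" where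
  "first_mat n m = mat n (n + m) (\<lambda>(i, k). if k = i then 1 else 0)"

definition last_emb :: "nat \<Rightarrow> nat \<Rightarrow> real mat" where
  "last_emb n m = mat (n + m) m (\<lambda>(i, k). if i = n + k then 1 else 0)"

lemma first_mat_mult:
  assumes "j \<in> carrier_vec (n + m)"
  shows "first_mat n m *\<^sub>v j = vec_first j n"
proof (rule eq_vecI)
  fix i assume "i < dim_vec (vec_first j n)"
  then have i: "i < n" by simp
  then have "(first_mat n m *\<^sub>v j) $ i = (\<Sum>k\<in>{0..<n + m}. (if k = i then 1 else 0) * j $ k)"
    using assms unfolding first_mat_def by (simp add: scalar_prod_def)
  also have "\<dots> = (\<Sum>k\<in>{0..<n + m}. if k = i then j $ k else 0)" by (rule sum.cong) simp_all
  finally show "(first_mat n m *\<^sub>v j) $ i = vec_first j n $ i"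
    using i by (simp add: vec_first_def)
qed (simp add: first_mat_def)

lemma first_last_mat_append:
  assumes v: "v \<in> carrier_vec n" and w: "w \<in> carrier_vec m"
  shows "transpose_mat (first_mat n m) *\<^sub>v v + last_emb n m *\<^sub>v w = v @\<^sub>v w"
proof (rule eq_vecI)
  fix i assume "i < dim_vec (v @\<^sub>v w)"
  then have i: "i < n + m" using v w by simp
  have "(transpose_mat (first_mat n m) *\<^sub>v v) $ i = (\<Sum>k\<in>{0..<n}. (if i = k then 1 else 0) * v $ k)"
    using i v unfolding first_mat_def by (simp add: scalar_prod_def)
  also have "\<dots> = (\<Sum>k\<in>{0..<n}. if k = i then v $ k else 0)" by (rule sum.cong) simp_all
  finally have "(transpose_mat (first_mat n m) *\<^sub>v v) $ i = (\<Sum>k\<in>{0..<n}. if k = i then v $ k else 0)" .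
  moreover have "(last_emb n m *\<^sub>v w) $ i = (\<Sum>k\<in>{0..<m}. (if i = n + k then 1 else 0) * w $ k)"
    using i w unfolding last_emb_def by (simp add: scalar_prod_def)
  moreover have "(\<Sum>k\<in>{0..<m}. (if i = n + k then 1 else 0) * w $ k) =
      (\<Sum>k\<in>{0..<m}. if i = n + k then w $ k else 0)" by (rule sum.cong) simp_all
  moreover have "(\<Sum>k\<in>{0..<m}. if i = n + k then w $ k else 0) = (if i < n then 0 else w $ (i - n))"
  proof (cases "i < n")
    case False
    then have "(\<Sum>k\<in>{0..<m}. if i = n + k then w $ k else 0) = (\<Sum>k\<in>{0..<m}. if k = i - n then w $ k else 0)"
      by (intro sum.cong) auto
    then show ?thesis using False i by simp
  qed (auto intro: sum.neutral)
  ultimately show "(transpose_mat (first_mat n m) *\<^sub>v v + last_emb n m *\<^sub>v w) $ i = (v @\<^sub>v w) $ i"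
    using i v w by (auto simp: first_mat_def last_emb_def simp del: index_mult_mat_vec)
qed (use v w in \<open>auto simp: first_mat_def last_emb_def\<close>)

text \<open>The scalar foil current and voltage become vectors of length one, so
  \<open>c_foil\<close> and \<open>A_foil\<close> have to act as one-column matrices.\<close>

definition col_mat :: "real vec \<Rightarrow> real mat" where
  "col_mat x = mat (dim_vec x) 1 (\<lambda>(i, _). x $ i)"

lemma col_mat_mult: "col_mat x *\<^sub>v vec 1 (\<lambda>_. r) = r \<cdot>\<^sub>v x"
  by (rule eq_vecI) (auto simp: col_mat_def scalar_prod_def)

lemma col_mat_transpose_mult: "transpose_mat (col_mat x) *\<^sub>v y = vec 1 (\<lambda>_. x \<bullet> y)"
proof (rule eq_vecI)
  have "col (col_mat x) 0 = x" by (rule eq_vecI) (auto simp: col_mat_def)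
  then show "(transpose_mat (col_mat x) *\<^sub>v y) $ i = vec 1 (\<lambda>_. x \<bullet> y) $ i"
    if "i < dim_vec (vec 1 (\<lambda>_. x \<bullet> y))" for i using that by (simp add: col_mat_def)
qed (simp add: col_mat_def)

lemma col_block_1: "k < dim_col A \<Longrightarrow> col_block A k 1 = col_mat (col A k)"
  unfolding col_block_def col_mat_def by (rule eq_matI) auto

lemma vec_1_eq_zero_iff: "- vec 1 (\<lambda>_. x) + vec 1 (\<lambda>_. y) = 0\<^sub>v 1 \<longleftrightarrow> - x + y = (0 :: real)"
proof
  assume "- vec 1 (\<lambda>_. x) + vec 1 (\<lambda>_. y) = 0\<^sub>v 1"
  then have "(- vec 1 (\<lambda>_. x) + vec 1 (\<lambda>_. y)) $ 0 = 0\<^sub>v 1 $ 0" by (rule arg_cong)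
  then show "- x + y = 0" by simp
next
  assume "- x + y = 0"
  then show "- vec 1 (\<lambda>_. x) + vec 1 (\<lambda>_. y) = 0\<^sub>v 1" by (intro eq_vecI) simp_all
qed

lemma zero_vec_append: "0\<^sub>v n @\<^sub>v 0\<^sub>v m = 0\<^sub>v (n + m)"
  by (rule eq_vecI) auto

lemma dim_ddt [simp]: "dim_vec (ddt T x t) = dim_vec (x t)"
  unfolding ddt_def by simp

lemma append_vNil [simp]: "x @\<^sub>v vNil = x"
  by (rule eq_vecI) auto

section \<open>The coupled model as an instance of the block system\<close>

theorem theorem16:
  fixes D :: model and t0 tf :: real
  assumes "t0 < tf" and "valid_model D"
  shows "\<exists>g1 g2 g3 n1 n2 n3 H e E J R B.
    is_grouping g1 g2 g3 \<and>
    admissible_structure n1 n2 n3 (n_isrc (circ D) + n_vsrc (circ D)) H e E J R B \<and>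
    (\<forall>s. signal_dims D {t0..tf} s \<longrightarrow>
      (\<forall>t \<in> {t0..tf}. component g1 s t \<in> carrier_vec n1 \<and>
         component g2 s t \<in> carrier_vec n2 \<and> component g3 s t \<in> carrier_vec n3) \<and>
      (coupled_model D {t0..tf} s \<longleftrightarrow>
         coupling_eqs D {t0..tf} s \<and>
         structured_system n1 n2 n3 H e E J R B {t0..tf}
           (component g1 s) (component g2 s) (component g3 s) (input s)))"
proof -
  define F1 F2 F3 where F: "F1 = field1 D" "F2 = field2 D" "F3 = field3 D"
  define St So Fo N where C: "St = strand D" "So = sol D" "Fo = foi D" "N = circ D"
  define w1 w2 w3 where w: "w1 = n_w F1" "w2 = n_w F2" "w3 = n_w F3"
  define np nl ns nso nfo ni nvs where n: "np = n_phi N - 1" "nl = n_L N" "ns = n_str St"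
    "nso = n_sol So" "nfo = n_p Fo" "ni = n_isrc N" "nvs = n_vsrc N"
  define Y where "Y = pinv (M_mat F3) * X_foil F3 Fo"
  define EC P where EC: "EC = A_C N * cap N * transpose_mat (A_C N)"
    and P: "P = A_R N * cond N * transpose_mat (A_R N)"
  define As Af Ai where As: "As = A_str St N" and Af: "Af = col_block (A_I N) ns 1"
    and Ai: "Ai = col_block (A_I N) (ns + 1) ni"
  have valid: "valid_field_model F1" "valid_field_model F2" "valid_field_model F3"
    "valid_stranded F1 St" "valid_solid F2 So" "valid_foil F3 Fo" "valid_circuit St So N"
    using assms(2) unfolding valid_model_def F C by auto
  have A: "A_C N \<in> carrier_mat np (n_C N)" "A_R N \<in> carrier_mat np (n_R N)"
    "A_L N \<in> carrier_mat np nl" "A_V N \<in> carrier_mat np (nso + nvs)"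
    "A_I N \<in> carrier_mat np (ns + (1 + ni))"
    and posdef: "sym_pos_def (n_C N) (cap N)" "sym_pos_def (n_R N) (cond N)" "sym_pos_def nl (indu N)"
    using valid(7) unfolding valid_circuit_def incidence_mat_def n by (auto simp: add.assoc)
  have Xo: "X_sol So \<in> carrier_mat w2 nso"
    using valid(5) unfolding valid_solid_def w n by auto
  have symM: "symmetric_mat w2 (M_mat F2)" "symmetric_mat w3 (M_mat F3)"
    unfolding M_mat_def w by (rule symmetric_mat_mass_mat)+
  have pinvM: "symmetric_mat w3 (pinv (M_mat F3))" using symM(2) by (rule symmetric_mat_pinv)
  have Y: "Y \<in> carrier_mat w3 nfo"
    using pinvM unfolding Y_def symmetric_mat_def w n by (intro mult_carrier_mat[OF _ X_foil_carrier]) auto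
  have MY: "M_mat F3 * Y = X_foil F3 Fo"
    unfolding Y_def using valid(3,6) by (rule M_pinv_X_foil)
  interpret cb: coupled_blocks w1 w2 w3 np nl ns nso nfo "nso + nvs" ni nvs
    "K_mat F1" "K_mat F2" "K_mat F3" "M_mat F1" "M_mat F2" "M_mat F3" "X_str F1 St" "R_str F1 St"
    "X_sol So" Y "col_mat (c_foil Fo)" EC "indu N" P "A_L N" "A_V N" As Af Ai
    "first_mat nso nvs" "last_emb nso nvs"
  proof
    show "symmetric_mat w1 (K_mat F1)" "symmetric_mat w2 (K_mat F2)" "symmetric_mat w3 (K_mat F3)"
      unfolding w by (rule symmetric_mat_K_mat)+
    show "sym_pos_semidef w1 (M_mat F1)" "sym_pos_semidef w2 (M_mat F2)" "sym_pos_semidef w3 (M_mat F3)"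
      unfolding w by (rule sym_pos_semidef_M_mat, rule valid)+
    show "sym_pos_semidef ns (R_str F1 St)"
      unfolding n using valid(1,4) by (rule sym_pos_semidef_R_str)
    show "sym_pos_semidef np P" unfolding P using posdef(2) A(2) by (rule sym_pos_semidef_outer_congruence)
    show "symmetric_mat np EC"
      using sym_pos_semidef_outer_congruence[OF posdef(1) A(1)] unfolding EC sym_pos_semidef_def by blast
    show "symmetric_mat nl (indu N)" using posdef(3) unfolding sym_pos_def_def by blast
    show "X_str F1 St \<in> carrier_mat w1 ns" unfolding X_str_def w n by simp
    show "col_mat (c_foil Fo) \<in> carrier_mat nfo 1" unfolding col_mat_def c_foil_def n by simp
    show "As \<in> carrier_mat np ns" "Af \<in> carrier_mat np 1" "Ai \<in> carrier_mat np ni"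
      using A(5) unfolding As Af Ai A_str_def n col_block_def by auto
    show "first_mat nso nvs \<in> carrier_mat nso (nso + nvs)" "last_emb nso nvs \<in> carrier_mat (nso + nvs) nvs"
      unfolding first_mat_def last_emb_def by auto
  qed (rule Xo Y A)+
  let ?T = "{t0..tf}"
  let ?n1 = "w1 + w2 + w3" and ?n2 = "np + nl" and ?n3 = "ns + nso + nfo + 1 + (nso + nvs)"
  have Mt: "transpose_mat (M_mat F2) = M_mat F2" "transpose_mat (M_mat F3) = M_mat F3"
    "transpose_mat (pinv (M_mat F3)) = pinv (M_mat F3)"
    using symM pinvM unfolding symmetric_mat_def by auto
  have M3c: "M_mat F3 \<in> carrier_mat w3 w3" "pinv (M_mat F3) \<in> carrier_mat w3 w3"
    using symM pinvM unfolding symmetric_mat_def by auto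
  have Gsol: "transpose_mat (X_sol So) * (M_mat F2 * X_sol So) = G_sol F2 So"
    unfolding G_sol_def using Xo symM(1) unfolding symmetric_mat_def
    by (simp add: mult_mat_assoc del: assoc_mult_mat)
  \<comment> \<open>Here the substitution by \<open>Y\<close> is undone: transposing
    \<open>M_mat F3 * Y = X_foil F3 Fo\<close> recovers the coupling in the terminal row, and the
    symmetry of the pseudo-inverse recovers \<open>G_foil\<close>.\<close>
  have XfT: "transpose_mat Y * M_mat F3 = transpose_mat (X_foil F3 Fo)"
    unfolding MY[symmetric] transpose_mult[OF M3c(1) Y] Mt ..
  have "transpose_mat Y = transpose_mat (X_foil F3 Fo) * pinv (M_mat F3)"
    unfolding Y_def transpose_mult[OF M3c(2)[unfolded w] X_foil_carrier] Mt ..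
  then have Gfoil: "transpose_mat Y * X_foil F3 Fo = G_foil F3 Fo"
    unfolding G_foil_def by simp
  have AI: "A_I N *\<^sub>v (x @\<^sub>v y @\<^sub>v z) = As *\<^sub>v x + (Af *\<^sub>v y + Ai *\<^sub>v z)"
    if "x \<in> carrier_vec ns" "y \<in> carrier_vec 1" "z \<in> carrier_vec ni" for x y z
  proof -
    have yz: "y @\<^sub>v z \<in> carrier_vec (1 + ni)"
      by (rule carrier_vecI) (simp add: carrier_vecD[OF that(2)] carrier_vecD[OF that(3)])
    have "A_I N *\<^sub>v (x @\<^sub>v y @\<^sub>v z) = col_block (A_I N) 0 (ns + (1 + ni)) *\<^sub>v (x @\<^sub>v y @\<^sub>v z)"
      unfolding col_block_all[OF A(5)] ..
    also have "\<dots> = col_block (A_I N) 0 ns *\<^sub>v x + col_block (A_I N) ns (1 + ni) *\<^sub>v (y @\<^sub>v z)"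
      using col_block_mult_append[OF that(1) yz, of "A_I N" 0] unfolding add_0 .
    also have "\<dots> = col_block (A_I N) 0 ns *\<^sub>v x
        + (col_block (A_I N) ns 1 *\<^sub>v y + col_block (A_I N) (ns + 1) ni *\<^sub>v z)"
      unfolding col_block_mult_append[OF that(2,3)] ..
    finally show ?thesis unfolding As Af Ai A_str_def n(3) .
  qed
  have Af_col: "Af = col_mat (A_foil St N)"
    unfolding Af A_foil_def n(3)[symmetric] by (rule col_block_1) (use carrier_matD(2)[OF A(5)] in simp)
  \<comment> \<open>The numbers are positions in \<open>remaining\<close>. The potentials form the
    first component, \<open>phi\<close> and \<open>j_L\<close> the second, and the five unknowns
    whose derivatives do not occur form the third.\<close>
  have main: "(\<forall>t \<in> ?T. component [0, 2, 4] s t \<in> carrier_vec ?n1 \<and>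
       component [7, 8] s t \<in> carrier_vec ?n2 \<and> component [1, 3, 5, 6, 9] s t \<in> carrier_vec ?n3) \<and>
      (coupled_model D ?T s \<longleftrightarrow> coupling_eqs D ?T s \<and>
         structured_system ?n1 ?n2 ?n3 cb.Ham (\<lambda>z1 z2. z2) cb.Em cb.Jm cb.Rm cb.Bm ?T
           (component [0, 2, 4] s) (component [7, 8] s) (component [1, 3, 5, 6, 9] s) (input s))"
    if sd: "signal_dims D ?T s" for s
  proof -
    have car: "a1 s t \<in> carrier_vec w1" "a2 s t \<in> carrier_vec w2" "a3 s t \<in> carrier_vec w3"
      "i_str s t \<in> carrier_vec ns" "v_sol s t \<in> carrier_vec nso" "e_foil s t \<in> carrier_vec nfo"
      "phi s t \<in> carrier_vec np" "j_L s t \<in> carrier_vec nl" "j_V s t \<in> carrier_vec (nso + nvs)"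
      "i_src s t \<in> carrier_vec ni" "v_src s t \<in> carrier_vec nvs" if "t \<in> ?T" for t
      using sd that unfolding signal_dims_def w n F C by auto
    note dim = car[THEN carrier_vecD]
    have comp: "component [0, 2, 4] s = (\<lambda>t. a1 s t @\<^sub>v (a2 s t @\<^sub>v a3 s t))"
      "component [7, 8] s = (\<lambda>t. phi s t @\<^sub>v j_L s t)"
      "component [1, 3, 5, 6, 9] s = (\<lambda>t. i_str s t @\<^sub>v (v_sol s t @\<^sub>v (e_foil s t @\<^sub>v
        (vec 1 (\<lambda>_. i_foil s t) @\<^sub>v j_V s t))))"
      unfolding component_def remaining_def by (simp_all add: fun_eq_iff)
    have dcomp: "ddt ?T (component [0, 2, 4] s) t = vec_concat [ddt ?T (a1 s) t, ddt ?T (a2 s) t, ddt ?T (a3 s) t]"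
      "ddt ?T (component [7, 8] s) t = vec_concat [ddt ?T (phi s) t, ddt ?T (j_L s) t]" if "t \<in> ?T" for t
    proof -
      have "ddt ?T (\<lambda>t. a2 s t @\<^sub>v a3 s t) t = ddt ?T (a2 s) t @\<^sub>v ddt ?T (a3 s) t"
        by (rule ddt_append[OF dim(2,3) that])
      moreover have "ddt ?T (\<lambda>t. a1 s t @\<^sub>v (a2 s t @\<^sub>v a3 s t)) t =
          ddt ?T (a1 s) t @\<^sub>v ddt ?T (\<lambda>t. a2 s t @\<^sub>v a3 s t) t"
        by (rule ddt_append[OF dim(1) _ that, where m = "w2 + w3"]) (simp_all add: dim)
      moreover have "ddt ?T (\<lambda>t. phi s t @\<^sub>v j_L s t) t = ddt ?T (phi s) t @\<^sub>v ddt ?T (j_L s) t"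
        by (rule ddt_append[OF dim(7,8) that])
      ultimately show "ddt ?T (component [0, 2, 4] s) t = vec_concat [ddt ?T (a1 s) t, ddt ?T (a2 s) t, ddt ?T (a3 s) t]"
        "ddt ?T (component [7, 8] s) t = vec_concat [ddt ?T (phi s) t, ddt ?T (j_L s) t]"
        unfolding comp by simp_all
    qed
    \<comment> \<open>The model demands differentiability of exactly the blocks of the first two
      components, so this requirement transfers in both directions.\<close>
    have diff: "vec_differentiable_on (component [0, 2, 4] s) ?T \<longleftrightarrow> vec_differentiable_on (a1 s) ?T \<and>
        vec_differentiable_on (a2 s) ?T \<and> vec_differentiable_on (a3 s) ?T"
      "vec_differentiable_on (component [7, 8] s) ?T \<longleftrightarrow>
        vec_differentiable_on (phi s) ?T \<and> vec_differentiable_on (j_L s) ?T"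
    proof -
      have "vec_differentiable_on (\<lambda>t. a2 s t @\<^sub>v a3 s t) ?T \<longleftrightarrow>
          vec_differentiable_on (a2 s) ?T \<and> vec_differentiable_on (a3 s) ?T"
        by (rule vec_differentiable_on_append[OF dim(2,3)])
      moreover have "vec_differentiable_on (\<lambda>t. a1 s t @\<^sub>v (a2 s t @\<^sub>v a3 s t)) ?T \<longleftrightarrow>
          vec_differentiable_on (a1 s) ?T \<and> vec_differentiable_on (\<lambda>t. a2 s t @\<^sub>v a3 s t) ?T"
        by (rule vec_differentiable_on_append[OF dim(1), where m = "w2 + w3"]) (simp_all add: dim)
      ultimately show "vec_differentiable_on (component [0, 2, 4] s) ?T \<longleftrightarrow> vec_differentiable_on (a1 s) ?T \<and>
          vec_differentiable_on (a2 s) ?T \<and> vec_differentiable_on (a3 s) ?T"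
        unfolding comp by blast
      show "vec_differentiable_on (component [7, 8] s) ?T \<longleftrightarrow>
        vec_differentiable_on (phi s) ?T \<and> vec_differentiable_on (j_L s) ?T"
        unfolding comp by (rule vec_differentiable_on_append[OF dim(7,8)])
    qed
    define str_eq where "str_eq t \<longleftrightarrow>
      M_mat F1 *\<^sub>v ddt ?T (a1 s) t + K_mat F1 *\<^sub>v a1 s t - X_str F1 St *\<^sub>v i_str s t = 0\<^sub>v w1 \<and>
      transpose_mat (X_str F1 St) *\<^sub>v ddt ?T (a1 s) t + R_str F1 St *\<^sub>v i_str s t - v_str s t = 0\<^sub>v ns" for t
    define sol_eq where "sol_eq t \<longleftrightarrow>
      M_mat F2 *\<^sub>v ddt ?T (a2 s) t + K_mat F2 *\<^sub>v a2 s t - (M_mat F2 * X_sol So) *\<^sub>v v_sol s t = 0\<^sub>v w2 \<and>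
      - ((transpose_mat (X_sol So) * transpose_mat (M_mat F2)) *\<^sub>v ddt ?T (a2 s) t)
        + G_sol F2 So *\<^sub>v v_sol s t - i_sol s t = 0\<^sub>v nso" for t
    define foil_eq where "foil_eq t \<longleftrightarrow>
      M_mat F3 *\<^sub>v ddt ?T (a3 s) t + K_mat F3 *\<^sub>v a3 s t - X_foil F3 Fo *\<^sub>v e_foil s t = 0\<^sub>v w3 \<and>
      - (transpose_mat (X_foil F3 Fo) *\<^sub>v ddt ?T (a3 s) t)
        + G_foil F3 Fo *\<^sub>v e_foil s t - i_foil s t \<cdot>\<^sub>v c_foil Fo = 0\<^sub>v nfo \<and>
      - (c_foil Fo \<bullet> e_foil s t) + v_foil s t = 0" for t
    define circ_eq where "circ_eq t \<longleftrightarrow>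
      EC *\<^sub>v ddt ?T (phi s) t + P *\<^sub>v phi s t
        + A_L N *\<^sub>v j_L s t + A_V N *\<^sub>v j_V s t + A_I N *\<^sub>v i_all s t = 0\<^sub>v np \<and>
      indu N *\<^sub>v ddt ?T (j_L s) t - transpose_mat (A_L N) *\<^sub>v phi s t = 0\<^sub>v nl \<and>
      transpose_mat (A_V N) *\<^sub>v phi s t - v_all s t = 0\<^sub>v (nso + nvs)" for t
    have model: "stranded_eqs D ?T s \<longleftrightarrow> vec_differentiable_on (a1 s) ?T \<and> (\<forall>t\<in>?T. str_eq t)"
      "solid_eqs D ?T s \<longleftrightarrow> vec_differentiable_on (a2 s) ?T \<and> (\<forall>t\<in>?T. sol_eq t)"
      "foil_eqs D ?T s \<longleftrightarrow> vec_differentiable_on (a3 s) ?T \<and> (\<forall>t\<in>?T. foil_eq t)"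
      "circuit_eqs D ?T s \<longleftrightarrow> vec_differentiable_on (phi s) ?T \<and> vec_differentiable_on (j_L s) ?T \<and>
        (\<forall>t\<in>?T. circ_eq t)"
      unfolding stranded_eqs_def solid_eqs_def foil_eqs_def circuit_eqs_def Let_def
        str_eq_def sol_eq_def foil_eq_def circ_eq_def EC P w n F C by (rule refl)+
    \<comment> \<open>Given the coupling relations, the equivalence holds at each time separately:
      after elimination of \<open>i_all\<close>, \<open>v_all\<close>, \<open>i_sol\<close>,
      \<open>v_str\<close> and \<open>v_foil\<close>, the conjuncts of \<open>cb.system_iff\<close>
      are literally the model equations.\<close>
    have point: "grad1 ?n1 cb.Ham (component [0, 2, 4] s t) (component [7, 8] s t)
          @\<^sub>v (cb.Em *\<^sub>v ddt ?T (component [7, 8] s) t) @\<^sub>v 0\<^sub>v ?n3 =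
        (cb.Jm - cb.Rm) *\<^sub>v (ddt ?T (component [0, 2, 4] s) t @\<^sub>v component [7, 8] s t
          @\<^sub>v component [1, 3, 5, 6, 9] s t) + cb.Bm *\<^sub>v input s t \<longleftrightarrow>
        str_eq t \<and> sol_eq t \<and> foil_eq t \<and> circ_eq t"
      if t: "t \<in> ?T" and coup: "coupling_eqs D ?T s" for t
    proof -
      have cp: "i_all s t = i_str s t @\<^sub>v vec 1 (\<lambda>_. i_foil s t) @\<^sub>v i_src s t"
        "v_all s t = v_sol s t @\<^sub>v v_src s t" "i_sol s t = vec_first (j_V s t) nso"
        "v_str s t = transpose_mat As *\<^sub>v phi s t" "v_foil s t = A_foil St N \<bullet> phi s t"
        using coup t unfolding coupling_eqs_def Let_def As n C by auto
      note dim = dim[OF t]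
      let ?y = "[ddt ?T (a1 s) t, ddt ?T (a2 s) t, ddt ?T (a3 s) t, phi s t, j_L s t, i_str s t, v_sol s t,
        e_foil s t, vec 1 (\<lambda>_. i_foil s t), j_V s t]"
      have y: "dims ?y = cb.bdims" and x: "dims [a1 s t, a2 s t, a3 s t] = [w1, w2, w3]"
        and x': "dims [ddt ?T (phi s) t, ddt ?T (j_L s) t] = [np, nl]"
        and u: "dims [i_src s t, v_src s t] = [ni, nvs]"
        unfolding cb.bdims_def by (simp_all add: dim)
      have z1: "component [0, 2, 4] s t = vec_concat [a1 s t, a2 s t, a3 s t]" unfolding comp by simp
      have "grad1 ?n1 cb.Ham (component [0, 2, 4] s t) (component [7, 8] s t) =
          cb.Km *\<^sub>v vec_concat [a1 s t, a2 s t, a3 s t]"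
        unfolding cb.Ham_def[abs_def] z1
        by (rule grad1_quad[OF cb.K_mat_block(1)], rule carrier_vecI) (simp add: dim)
      then have g: "grad1 ?n1 cb.Ham (component [0, 2, 4] s t) (component [7, 8] s t) =
          vec_concat (cb.K_op [a1 s t, a2 s t, a3 s t])"
        unfolding cb.K_mat_block(2)[OF x] .
      have E: "cb.Em *\<^sub>v ddt ?T (component [7, 8] s) t =
          vec_concat (cb.E_op [ddt ?T (phi s) t, ddt ?T (j_L s) t])"
        unfolding dcomp[OF t] by (rule cb.E_mat_block(2)[OF x'])
      have zero: "0\<^sub>v ?n3 = vec_concat [0\<^sub>v ns, 0\<^sub>v nso, 0\<^sub>v nfo, 0\<^sub>v 1, 0\<^sub>v (nso + nvs) :: real vec]"
        by (simp add: zero_vec_append add.assoc)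
      have rhs: "ddt ?T (component [0, 2, 4] s) t @\<^sub>v component [7, 8] s t @\<^sub>v component [1, 3, 5, 6, 9] s t =
          vec_concat ?y" "input s t = vec_concat [i_src s t, v_src s t]"
        unfolding dcomp[OF t] unfolding comp input_def by (simp_all add: append_vec_assoc)
      have foil1: "- (c_foil Fo \<bullet> e_foil s t) + v_foil s t = 0 \<longleftrightarrow>
          - (transpose_mat (col_mat (c_foil Fo)) *\<^sub>v e_foil s t) + transpose_mat Af *\<^sub>v phi s t = 0\<^sub>v 1"
        unfolding Af_col col_mat_transpose_mult vec_1_eq_zero_iff cp(5) ..
      have AIi: "A_I N *\<^sub>v i_all s t = As *\<^sub>v i_str s t + (Af *\<^sub>v vec 1 (\<lambda>_. i_foil s t) + Ai *\<^sub>v i_src s t)"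
        unfolding cp(1) using car[OF t] by (intro AI) auto
      have v: "v_all s t = transpose_mat (first_mat nso nvs) *\<^sub>v v_sol s t + last_emb nso nvs *\<^sub>v v_src s t"
        unfolding cp(2) by (rule first_last_mat_append[symmetric]) (rule car[OF t])+
      have isol: "i_sol s t = first_mat nso nvs *\<^sub>v j_V s t"
        unfolding cp(3) by (rule first_mat_mult[symmetric]) (rule car[OF t])
      show ?thesis
        unfolding g E zero rhs vec_concat_append[symmetric] cb.system_iff[OF y x x' u]
          str_eq_def sol_eq_def foil_eq_def circ_eq_def foil1 AIi v isol cp(4) Mt MY XfT Gsol Gfoil
          col_mat_mult conj_assoc
        by (rule refl)
    qed
    have "coupled_model D ?T s \<longleftrightarrow> coupling_eqs D ?T s \<and>
         structured_system ?n1 ?n2 ?n3 cb.Ham (\<lambda>z1 z2. z2) cb.Em cb.Jm cb.Rm cb.Bm ?T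
           (component [0, 2, 4] s) (component [7, 8] s) (component [1, 3, 5, 6, 9] s) (input s)"
      unfolding coupled_model_def structured_system_def model diff using point by blast
    moreover have "component [0, 2, 4] s t \<in> carrier_vec ?n1 \<and> component [7, 8] s t \<in> carrier_vec ?n2 \<and>
        component [1, 3, 5, 6, 9] s t \<in> carrier_vec ?n3" if "t \<in> ?T" for t
      unfolding comp by (intro conjI carrier_vecI) (simp_all add: dim[OF that])
    ultimately show ?thesis by blast
  qed
  have "is_grouping [0, 2, 4] [7, 8] [1, 3, 5, 6, 9]"
    unfolding is_grouping_def by (auto simp: lessThan_nat_numeral lessThan_Suc)
  with main cb.admissible show ?thesis unfolding n C by blast
qed

end
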